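(* Let $R\subseteq T$ be rings forming a regular conductor square with conductor $C$, and set $A=R/C$, $B=T/C$. Assume that $T$ is flat as an $R$-module, that $C$ is a principal ideal of $T$, and that every non-zero 2-generated ideal $I$ of $R$ satisfies the following condition: there are elements $r,s\in R$ and an ideal $U\subseteq R$ such that $UT=T=rT$ and $rI=sU$, and such that the multiplication maps $I\xrightarrow{r}rI$ and $U\xrightarrow{s}sU$ are isomorphisms. Assume further that $A$ is locally a domain and has finite Krull dimension. Then $R$ is a finite conductor ring if and only if $A$ is a finite conductor ring; each of these conditions implies that $T$ is a finite conductor ring.
   Context: All rings are commutative with identity. A conductor square consists of a ring $T$, a subring $R\subseteq T$ such that $R$ and $T$ have a common non-zero ideal, the largest common ideal $C$ of $R$ and $T$ (called the conductor of $T$ into $R$), and the rings $A=R/C$ and $B=T/C$, together with the inclusions $R\hookrightarrow T$, $A\hookrightarrow B$ and the projections $\eta_2\colon R\twoheadrightarrow A$, $\eta_1\colon T\twoheadrightarrow B$; equivalently, $R$ is the pullback $\{(a,t)\in A\times T\mid a=\eta_1(t)\text{ in }B\}$ and $C=\operatorname{Ker}(\eta_1)=\operatorname{Ker}(\eta_2)$ is the largest common ideal. The square is regular if $C$ contains a non-zero-divisor of $T$. An ideal is 2-generated if it can be generated by two elements. A ring is a finite conductor ring if every 2-generated ideal of it is finitely presented. A ring $A$ is locally a domain if $A_{\mathfrak p}$ is an integral domain for every prime ideal $\mathfrak p$ of $A$. *)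

theory Defs
  imports "HOL-Algebra.Algebra" "HOL-Library.Extended_Nat"
begin

section \<open>Modules\<close>

definition module_hom ::
  "('a, 'm) ring_scheme \<Rightarrow> ('a, 'b, 'n) module_scheme \<Rightarrow> ('a, 'c, 'k) module_scheme \<Rightarrow> ('b \<Rightarrow> 'c) set"
  where "module_hom R M N =
    {f \<in> carrier M \<rightarrow> carrier N.
      (\<forall>x\<in>carrier M. \<forall>y\<in>carrier M. f (x \<oplus>\<^bsub>M\<^esub> y) = f x \<oplus>\<^bsub>N\<^esub> f y) \<and>
      (\<forall>a\<in>carrier R. \<forall>x\<in>carrier M. f (a \<odot>\<^bsub>M\<^esub> x) = a \<odot>\<^bsub>N\<^esub> f x)}"

definition module_iso ::
  "('a, 'm) ring_scheme \<Rightarrow> ('a, 'b, 'n) module_scheme \<Rightarrow> ('a, 'c, 'k) module_scheme \<Rightarrow> ('b \<Rightarrow> 'c) set"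
  where "module_iso R M N = {f \<in> module_hom R M N. bij_betw f (carrier M) (carrier N)}"

text \<open>A subset \<open>I\<close> of a ring \<open>T\<close>, with scalars acting by the multiplication of \<open>T\<close>. It is used
  for an ideal as a module over its ring, and for \<open>T\<close> as a module over a subring. The fields
  \<open>mult\<close> and \<open>one\<close>, which a module record inherits from rings, play no role.\<close>

definition mult_module :: "('a, 'm) ring_scheme \<Rightarrow> 'a set \<Rightarrow> ('a, 'a) module"
  where "mult_module T I =
    \<lparr>carrier = I, monoid.mult = (\<otimes>\<^bsub>T\<^esub>), one = \<one>\<^bsub>T\<^esub>, ring.zero = \<zero>\<^bsub>T\<^esub>, add = (\<oplus>\<^bsub>T\<^esub>),
     smult = (\<otimes>\<^bsub>T\<^esub>)\<rparr>"

definition free_module :: "('a, 'm) ring_scheme \<Rightarrow> nat \<Rightarrow> ('a, nat \<Rightarrow> 'a) module"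
  where "free_module R n =
    \<lparr>carrier = {..<n} \<rightarrow>\<^sub>E carrier R,
     monoid.mult = (\<lambda>x y. \<lambda>i\<in>{..<n}. x i \<otimes>\<^bsub>R\<^esub> y i), one = (\<lambda>i\<in>{..<n}. \<one>\<^bsub>R\<^esub>),
     ring.zero = (\<lambda>i\<in>{..<n}. \<zero>\<^bsub>R\<^esub>), add = (\<lambda>x y. \<lambda>i\<in>{..<n}. x i \<oplus>\<^bsub>R\<^esub> y i),
     smult = (\<lambda>a x. \<lambda>i\<in>{..<n}. a \<otimes>\<^bsub>R\<^esub> x i)\<rparr>"

lemma module_free: assumes "cring R" shows "module R (free_module R n)"
proof -
  interpret cring R by fact
  show ?thesis
  proof (rule moduleI)
    show "abelian_group (free_module R n)"
    proof (rule abelian_groupI)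
      fix x assume "x \<in> carrier (free_module R n)"
      then show "\<exists>y\<in>carrier (free_module R n). y \<oplus>\<^bsub>free_module R n\<^esub> x = \<zero>\<^bsub>free_module R n\<^esub>"
        by (intro bexI[of _ "\<lambda>i\<in>{..<n}. \<ominus>\<^bsub>R\<^esub> x i"]) (auto simp: free_module_def PiE_iff l_neg fun_eq_iff)
    qed (auto simp: free_module_def PiE_iff a_ac fun_eq_iff extensional_def)
  qed (auto simp: free_module_def PiE_iff fun_eq_iff m_assoc l_distr r_distr extensional_def is_cring)
qed

lemma module_subring: assumes "cring T" "subcring R T" shows "module (T\<lparr>carrier := R\<rparr>) (mult_module T (carrier T))"
proof -
  interpret cring T by fact
  note R = subcringE(1)[OF assms(2)]
  have R': "\<And>x. x \<in> R \<Longrightarrow> x \<in> carrier T" using R by auto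
  show ?thesis
  proof (rule moduleI)
    show "cring (T\<lparr>carrier := R\<rparr>)" using subcring_iff[OF R] assms by blast
    show "abelian_group (mult_module T (carrier T))"
      by (rule abelian_groupI) (auto simp: mult_module_def a_ac intro: bexI[of _ "\<ominus>\<^bsub>T\<^esub> x" for x] l_neg)
  qed (auto simp: mult_module_def m_assoc l_distr r_distr R')
qed

lemma module_ideal: assumes "cring R" "ideal I R" shows "module R (mult_module R I)"
proof -
  interpret ideal I R by fact
  interpret cring R by fact
  show ?thesis
  proof (rule moduleI)
    show "abelian_group (mult_module R I)"
    proof (rule abelian_groupI)
      fix x assume "x \<in> carrier (mult_module R I)"
      then show "\<exists>y\<in>carrier (mult_module R I). y \<oplus>\<^bsub>mult_module R I\<^esub> x = \<zero>\<^bsub>mult_module R I\<^esub>"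
        by (intro bexI[of _ "\<ominus>\<^bsub>R\<^esub> x"]) (auto simp: mult_module_def l_neg)
    qed (auto simp: mult_module_def a_ac)
  qed (auto simp: mult_module_def m_assoc l_distr r_distr I_l_closed is_cring)
qed

text \<open>There is an exact sequence \<open>R\<^sup>m \<rightarrow> R\<^sup>n \<rightarrow> M \<rightarrow> 0\<close>.\<close>

definition finitely_presented :: "('a, 'm) ring_scheme \<Rightarrow> ('a, 'b, 'n) module_scheme \<Rightarrow> bool"
  where "finitely_presented R M \<longleftrightarrow> module R M \<and>
    (\<exists>m n. \<exists>\<psi>\<in>module_hom R (free_module R m) (free_module R n). \<exists>\<phi>\<in>module_hom R (free_module R n) M.
      \<phi> ` carrier (free_module R n) = carrier M \<and>
      \<psi> ` carrier (free_module R m) = {x \<in> carrier (free_module R n). \<phi> x = \<zero>\<^bsub>M\<^esub>})"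


section \<open>Tensor products and flatness\<close>

text \<open>The abelian group \<open>M \<otimes>\<^sub>R N\<close>, as the quotient of the free abelian group on
  \<open>carrier M \<times> carrier N\<close> by the subgroup generated by the bilinearity relations.\<close>

definition tensor_relations ::
  "('a, 'm) ring_scheme \<Rightarrow> ('a, 'b, 'n) module_scheme \<Rightarrow> ('a, 'c, 'k) module_scheme \<Rightarrow> ('b \<times> 'c \<Rightarrow>\<^sub>0 int) set"
  where "tensor_relations R M N =
    {frag_of (x \<oplus>\<^bsub>M\<^esub> x', y) - frag_of (x, y) - frag_of (x', y) | x x' y.
       x \<in> carrier M \<and> x' \<in> carrier M \<and> y \<in> carrier N} \<union>
    {frag_of (x, y \<oplus>\<^bsub>N\<^esub> y') - frag_of (x, y) - frag_of (x, y') | x y y'.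
       x \<in> carrier M \<and> y \<in> carrier N \<and> y' \<in> carrier N} \<union>
    {frag_of (a \<odot>\<^bsub>M\<^esub> x, y) - frag_of (x, a \<odot>\<^bsub>N\<^esub> y) | a x y.
       a \<in> carrier R \<and> x \<in> carrier M \<and> y \<in> carrier N}"

definition tensor_subgroup ::
  "('a, 'm) ring_scheme \<Rightarrow> ('a, 'b, 'n) module_scheme \<Rightarrow> ('a, 'c, 'k) module_scheme \<Rightarrow> ('b \<times> 'c \<Rightarrow>\<^sub>0 int) set"
  where "tensor_subgroup R M N =
    generate (free_Abelian_group (carrier M \<times> carrier N)) (tensor_relations R M N)"

definition tensor_product ::
  "('a, 'm) ring_scheme \<Rightarrow> ('a, 'b, 'n) module_scheme \<Rightarrow> ('a, 'c, 'k) module_scheme \<Rightarrow> ('b \<times> 'c \<Rightarrow>\<^sub>0 int) set monoid"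
  where "tensor_product R M N =
    free_Abelian_group (carrier M \<times> carrier N) Mod tensor_subgroup R M N"

definition tensor_coset ::
  "('a, 'm) ring_scheme \<Rightarrow> ('a, 'b, 'n) module_scheme \<Rightarrow> ('a, 'c, 'k) module_scheme \<Rightarrow> ('b \<times> 'c \<Rightarrow>\<^sub>0 int) \<Rightarrow> ('b \<times> 'c \<Rightarrow>\<^sub>0 int) set"
  where "tensor_coset R M N x =
    tensor_subgroup R M N #>\<^bsub>free_Abelian_group (carrier M \<times> carrier N)\<^esub> x"

text \<open>The map \<open>id \<otimes> f\<close> from \<open>M \<otimes>\<^sub>R N\<close> to \<open>M \<otimes>\<^sub>R N'\<close>, for a module homomorphism \<open>f\<close> from \<open>N\<close>
  to \<open>N'\<close>. It acts on cosets through representatives; the lemmas \<open>tensor_map_coset\<close> and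
  \<open>tensor_map_hom\<close> below say that it is well-defined.\<close>

definition tensor_map ::
  "('a, 'm) ring_scheme \<Rightarrow> ('a, 'b, 'n) module_scheme \<Rightarrow> ('a, 'd, 'l) module_scheme \<Rightarrow>
    ('c \<Rightarrow> 'd) \<Rightarrow> ('b \<times> 'c \<Rightarrow>\<^sub>0 int) set \<Rightarrow> ('b \<times> 'd \<Rightarrow>\<^sub>0 int) set"
  where "tensor_map R M N' f Z =
    the_elem ((\<lambda>x. tensor_coset R M N' (frag_extend (\<lambda>(m, n). frag_of (m, f n)) x)) ` Z)"

lemma tensor_subgroup_subgroup:
  assumes "module R M" "module R N"
  shows "tensor_relations R M N \<subseteq> carrier (free_Abelian_group (carrier M \<times> carrier N))"
    and "subgroup (tensor_subgroup R M N) (free_Abelian_group (carrier M \<times> carrier N))"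
    and "comm_group (tensor_product R M N)"
proof -
  interpret M: module R M by fact
  interpret N: module R N by fact
  let ?F = "free_Abelian_group (carrier M \<times> carrier N)"
  interpret F: comm_group ?F by (rule abelian_free_Abelian_group)
  have *: "a - b \<in> carrier ?F" if "a \<in> carrier ?F" "b \<in> carrier ?F" for a b
    using that keys_diff[of a b] by auto
  have ff: "p \<in> carrier M \<times> carrier N \<Longrightarrow> frag_of p \<in> carrier ?F" for p by simp
  show sub: "tensor_relations R M N \<subseteq> carrier ?F"
    unfolding tensor_relations_def by (intro Un_least subsetI; clarify; intro * ff; simp)
  show sg: "subgroup (tensor_subgroup R M N) ?F"
    unfolding tensor_subgroup_def by (rule F.generate_is_subgroup[OF sub])
  show "comm_group (tensor_product R M N)"
    unfolding tensor_product_def by (rule F.abelian_FactGroup[OF sg])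
qed

lemma tensor_extend_hom:
  assumes "module R M" "module R N" "module R N'" "f \<in> module_hom R N N'"
  defines "h \<equiv> frag_extend (\<lambda>(m, n). frag_of (m, f n))"
  shows "h \<in> hom (free_Abelian_group (carrier M \<times> carrier N)) (free_Abelian_group (carrier M \<times> carrier N'))"
    and "h ` tensor_subgroup R M N \<subseteq> tensor_subgroup R M N'"
proof -
  interpret M: module R M by fact
  interpret N: module R N by fact
  let ?F = "free_Abelian_group (carrier M \<times> carrier N)"
  let ?F' = "free_Abelian_group (carrier M \<times> carrier N')"
  have f: "\<And>n. n \<in> carrier N \<Longrightarrow> f n \<in> carrier N'" using assms(4) by (auto simp: module_hom_def)
  have hc: "h x \<in> carrier ?F'" if "x \<in> carrier ?F" for x
  proof -
    have "Poly_Mapping.keys (h x) \<subseteq> (\<Union>p\<in>Poly_Mapping.keys x. Poly_Mapping.keys (case p of (m, n) \<Rightarrow> frag_of (m, f n)))"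
      unfolding h_def by (rule keys_frag_extend)
    also have "\<dots> \<subseteq> carrier M \<times> carrier N'"
    proof
      fix q assume "q \<in> (\<Union>p\<in>Poly_Mapping.keys x. Poly_Mapping.keys (case p of (m, n) \<Rightarrow> frag_of (m, f n)))"
      then obtain m n where "(m, n) \<in> Poly_Mapping.keys x" "q = (m, f n)" by auto
      moreover have "Poly_Mapping.keys x \<subseteq> carrier M \<times> carrier N" using that by simp
      ultimately show "q \<in> carrier M \<times> carrier N'" using f by auto
    qed
    finally show ?thesis by simp
  qed
  show hom: "h \<in> hom ?F ?F'"
    by (rule homI) (use hc in \<open>auto simp: h_def frag_extend_add simp del: carrier_free_Abelian_group_iff\<close>)
  interpret h: group_hom ?F ?F' h
    by (intro group_hom.intro group_hom_axioms.intro group_free_Abelian_group hom)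
  have "h ` tensor_subgroup R M N = generate ?F' (h ` tensor_relations R M N)"
    unfolding tensor_subgroup_def
    by (rule h.generate_img[OF tensor_subgroup_subgroup(1)[OF assms(1,2)], symmetric] h.generate_img[OF tensor_subgroup_subgroup(1)[OF assms(1,2)]])
  moreover have "h ` tensor_relations R M N \<subseteq> tensor_relations R M N'"
  proof (clarify)
    fix z assume z: "z \<in> tensor_relations R M N"
    have [simp]: "h (p - q) = h p - h q" for p q by (simp add: h_def frag_extend_diff)
    have [simp]: "h (frag_of (m, n)) = frag_of (m, f n)" for m n by (simp add: h_def)
    have add: "\<And>x y. x \<in> carrier N \<Longrightarrow> y \<in> carrier N \<Longrightarrow> f (x \<oplus>\<^bsub>N\<^esub> y) = f x \<oplus>\<^bsub>N'\<^esub> f y"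
      and smult: "\<And>a x. a \<in> carrier R \<Longrightarrow> x \<in> carrier N \<Longrightarrow> f (a \<odot>\<^bsub>N\<^esub> x) = a \<odot>\<^bsub>N'\<^esub> f x"
      using assms(4) by (auto simp: module_hom_def)
    from z consider
      (1) x x' y where "z = frag_of (x \<oplus>\<^bsub>M\<^esub> x', y) - frag_of (x, y) - frag_of (x', y)"
        "x \<in> carrier M" "x' \<in> carrier M" "y \<in> carrier N"
    | (2) x y y' where "z = frag_of (x, y \<oplus>\<^bsub>N\<^esub> y') - frag_of (x, y) - frag_of (x, y')"
        "x \<in> carrier M" "y \<in> carrier N" "y' \<in> carrier N"
    | (3) a x y where "z = frag_of (a \<odot>\<^bsub>M\<^esub> x, y) - frag_of (x, a \<odot>\<^bsub>N\<^esub> y)"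
        "a \<in> carrier R" "x \<in> carrier M" "y \<in> carrier N"
      unfolding tensor_relations_def by blast
    then show "h z \<in> tensor_relations R M N'"
    proof cases
      case 1
      then have "h z = frag_of (x \<oplus>\<^bsub>M\<^esub> x', f y) - frag_of (x, f y) - frag_of (x', f y)" by simp
      then show ?thesis unfolding tensor_relations_def using 1(2-4) f by blast
    next
      case 2
      then have "h z = frag_of (x, f y \<oplus>\<^bsub>N'\<^esub> f y') - frag_of (x, f y) - frag_of (x, f y')" by (simp add: add)
      then show ?thesis unfolding tensor_relations_def using 2(2-4) f by blast
    next
      case 3
      then have "h z = frag_of (a \<odot>\<^bsub>M\<^esub> x, f y) - frag_of (x, a \<odot>\<^bsub>N'\<^esub> f y)" by (simp add: smult)
      then show ?thesis unfolding tensor_relations_def using 3(2-4) f by blast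
    qed
  qed
  ultimately show "h ` tensor_subgroup R M N \<subseteq> tensor_subgroup R M N'"
    unfolding tensor_subgroup_def using h.H.mono_generate by auto
qed

lemma tensor_map_coset:
  assumes "module R M" "module R N" "module R N'" "f \<in> module_hom R N N'"
    and x: "x \<in> carrier (free_Abelian_group (carrier M \<times> carrier N))"
  shows "tensor_map R M N' f (tensor_coset R M N x) =
    tensor_coset R M N' (frag_extend (\<lambda>(m, n). frag_of (m, f n)) x)"
proof -
  let ?F = "free_Abelian_group (carrier M \<times> carrier N)"
  let ?F' = "free_Abelian_group (carrier M \<times> carrier N')"
  let ?h = "frag_extend (\<lambda>(m, n). frag_of (m, f n))"
  let ?K = "tensor_subgroup R M N" and ?K' = "tensor_subgroup R M N'"
  note h = tensor_extend_hom[OF assms(1-4)]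
  interpret F: comm_group ?F by (rule abelian_free_Abelian_group)
  interpret F': comm_group ?F' by (rule abelian_free_Abelian_group)
  interpret K: subgroup ?K ?F by (rule tensor_subgroup_subgroup[OF assms(1,2)])
  interpret K': subgroup ?K' ?F' by (rule tensor_subgroup_subgroup[OF assms(1,3)])
  have hx: "?h x \<in> carrier ?F'" using hom_in_carrier[OF h(1) x] .
  have eq: "tensor_coset R M N' (?h y) = tensor_coset R M N' (?h x)" if y: "y \<in> tensor_coset R M N x" for y
  proof -
    obtain k where k: "k \<in> ?K" "y = k \<otimes>\<^bsub>?F\<^esub> x"
      using y unfolding tensor_coset_def r_coset_def by auto
    then have "?h y = ?h k \<otimes>\<^bsub>?F'\<^esub> ?h x" by (simp add: frag_extend_add)
    moreover have "?h k \<in> ?K'" using h(2) k by auto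
    ultimately have "?h y \<in> ?K' #>\<^bsub>?F'\<^esub> ?h x" unfolding r_coset_def by blast
    then show ?thesis unfolding tensor_coset_def
      using F'.repr_independence[OF _ hx K'.subgroup_axioms] by simp
  qed
  have "x \<in> tensor_coset R M N x"
    unfolding tensor_coset_def using F.rcos_self[OF x K.subgroup_axioms] .
  then have "(\<lambda>y. tensor_coset R M N' (?h y)) ` tensor_coset R M N x = {tensor_coset R M N' (?h x)}"
    using eq by blast
  then show ?thesis unfolding tensor_map_def by (simp only: the_elem_eq)
qed

lemma tensor_map_hom:
  assumes "module R M" "module R N" "module R N'" "f \<in> module_hom R N N'"
  shows "tensor_map R M N' f \<in> hom (tensor_product R M N) (tensor_product R M N')"
proof -
  let ?F = "free_Abelian_group (carrier M \<times> carrier N)"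
  let ?F' = "free_Abelian_group (carrier M \<times> carrier N')"
  let ?h = "frag_extend (\<lambda>(m, n). frag_of (m, f n))"
  note h = tensor_extend_hom[OF assms(1-4)]
  interpret F: comm_group ?F by (rule abelian_free_Abelian_group)
  interpret F': comm_group ?F' by (rule abelian_free_Abelian_group)
  interpret K: normal "tensor_subgroup R M N" ?F
    by (rule F.normal_iff_subgroup[THEN iffD2, OF tensor_subgroup_subgroup(2)[OF assms(1,2)]])
  interpret K': normal "tensor_subgroup R M N'" ?F'
    by (rule F'.normal_iff_subgroup[THEN iffD2, OF tensor_subgroup_subgroup(2)[OF assms(1,3)]])
  have car: "carrier (tensor_product R M N) = tensor_coset R M N ` carrier ?F"
    "carrier (tensor_product R M N') = tensor_coset R M N' ` carrier ?F'"
    by (auto simp: tensor_product_def tensor_coset_def carrier_FactGroup)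
  note hc = hom_in_carrier[OF h(1)]
  show ?thesis
  proof (rule homI)
    fix p assume "p \<in> carrier (tensor_product R M N)"
    then show "tensor_map R M N' f p \<in> carrier (tensor_product R M N')"
      unfolding car using hc by (auto simp: tensor_map_coset[OF assms] simp del: carrier_free_Abelian_group_iff)
  next
    fix p q assume "p \<in> carrier (tensor_product R M N)" "q \<in> carrier (tensor_product R M N)"
    then obtain x y where xy: "x \<in> carrier ?F" "p = tensor_coset R M N x" "y \<in> carrier ?F" "q = tensor_coset R M N y"
      unfolding car by blast
    have 1: "p \<otimes>\<^bsub>tensor_product R M N\<^esub> q = tensor_coset R M N (x \<otimes>\<^bsub>?F\<^esub> y)"
      using K.rcos_sum[OF xy(1,3)] xy by (simp add: tensor_product_def tensor_coset_def)
    have 2: "tensor_coset R M N' (?h x) \<otimes>\<^bsub>tensor_product R M N'\<^esub> tensor_coset R M N' (?h y)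
      = tensor_coset R M N' (?h x \<otimes>\<^bsub>?F'\<^esub> ?h y)"
      using K'.rcos_sum[OF hc[OF xy(1)] hc[OF xy(3)]] by (simp add: tensor_product_def tensor_coset_def)
    show "tensor_map R M N' f (p \<otimes>\<^bsub>tensor_product R M N\<^esub> q) =
        tensor_map R M N' f p \<otimes>\<^bsub>tensor_product R M N'\<^esub> tensor_map R M N' f q"
      unfolding 1 unfolding xy(2,4) tensor_map_coset[OF assms xy(1)] tensor_map_coset[OF assms xy(3)]
        tensor_map_coset[OF assms F.m_closed[OF xy(1,3)]] 2 hom_mult[OF h(1) xy(1,3)] ..
  qed
qed

text \<open>\<open>M\<close> is flat if \<open>M \<otimes>\<^sub>R _\<close> preserves injectivity of module homomorphisms. HOL cannot quantify
  over the modules on all types, so \<open>N\<close> and \<open>N'\<close> range over the modules whose elements are of the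
  same type as those of \<open>R\<close>. Nothing is lost: these include \<open>R\<close> and all its ideals, and by
  the ideal criterion for flatness a module \<open>M\<close> for which \<open>M \<otimes>\<^sub>R I \<rightarrow> M \<otimes>\<^sub>R R\<close> is injective for all ideals \<open>I\<close>
  is flat with respect to modules of every size.\<close>

definition flat_module :: "('a, 'm) ring_scheme \<Rightarrow> ('a, 'b, 'n) module_scheme \<Rightarrow> bool"
  where "flat_module R M \<longleftrightarrow> module R M \<and>
    (\<forall>(N :: ('a, 'a) module) (N' :: ('a, 'a) module) f.
      module R N \<longrightarrow> module R N' \<longrightarrow> f \<in> module_hom R N N' \<longrightarrow> inj_on f (carrier N) \<longrightarrow>
      inj_on (tensor_map R M N' f) (carrier (tensor_product R M N)))"


section \<open>Localization\<close>

definition fraction_rel :: "('a, 'm) ring_scheme \<Rightarrow> 'a set \<Rightarrow> (('a \<times> 'a) \<times> ('a \<times> 'a)) set"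
  where "fraction_rel A S =
    {((a, s), (b, t)). a \<in> carrier A \<and> s \<in> S \<and> b \<in> carrier A \<and> t \<in> S \<and>
      (\<exists>u\<in>S. u \<otimes>\<^bsub>A\<^esub> (a \<otimes>\<^bsub>A\<^esub> t \<ominus>\<^bsub>A\<^esub> b \<otimes>\<^bsub>A\<^esub> s) = \<zero>\<^bsub>A\<^esub>)}"

definition fraction :: "('a, 'm) ring_scheme \<Rightarrow> 'a set \<Rightarrow> 'a \<Rightarrow> 'a \<Rightarrow> ('a \<times> 'a) set"
  where "fraction A S a s = fraction_rel A S `` {(a, s)}"

definition localization :: "('a, 'm) ring_scheme \<Rightarrow> 'a set \<Rightarrow> ('a \<times> 'a) set ring"
  where "localization A S =
    \<lparr>carrier = (carrier A \<times> S) // fraction_rel A S,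
     monoid.mult = (\<lambda>p q. \<Union>(a, s)\<in>p. \<Union>(b, t)\<in>q. fraction A S (a \<otimes>\<^bsub>A\<^esub> b) (s \<otimes>\<^bsub>A\<^esub> t)),
     one = fraction A S \<one>\<^bsub>A\<^esub> \<one>\<^bsub>A\<^esub>,
     ring.zero = fraction A S \<zero>\<^bsub>A\<^esub> \<one>\<^bsub>A\<^esub>,
     add = (\<lambda>p q. \<Union>(a, s)\<in>p. \<Union>(b, t)\<in>q.
       fraction A S (a \<otimes>\<^bsub>A\<^esub> t \<oplus>\<^bsub>A\<^esub> b \<otimes>\<^bsub>A\<^esub> s) (s \<otimes>\<^bsub>A\<^esub> t))\<rparr>"

context cring begin

lemma fraction_rel_equiv:
  assumes "submonoid S R"
  shows "equiv (carrier R \<times> S) (fraction_rel R S)"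
proof -
  interpret S: submonoid S R by fact
  have S: "\<And>s. s \<in> S \<Longrightarrow> s \<in> carrier R" using S.subset by auto
  show ?thesis
  proof (rule equivI)
    show "refl_on (carrier R \<times> S) (fraction_rel R S)"
      by (rule refl_onI) (auto simp: fraction_rel_def S r_neg minus_eq intro!: bexI[of _ \<one>])
    show "fraction_rel R S \<subseteq> (carrier R \<times> S) \<times> carrier R \<times> S"
      by (auto simp: fraction_rel_def)
    show "sym (fraction_rel R S)"
    proof (rule symI)
      fix p q assume "(p, q) \<in> fraction_rel R S"
      then obtain a s b t u where pq: "p = (a, s)" "q = (b, t)" "a \<in> carrier R" "s \<in> S" "b \<in> carrier R" "t \<in> S"
        "u \<in> S" "u \<otimes> (a \<otimes> t \<ominus> b \<otimes> s) = \<zero>" unfolding fraction_rel_def by blast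
      note c = pq(3,5) S[OF pq(4)] S[OF pq(6)] S[OF pq(7)]
      have "u \<otimes> (b \<otimes> s \<ominus> a \<otimes> t) = \<ominus> (u \<otimes> (a \<otimes> t \<ominus> b \<otimes> s))" using c by algebra
      also have "\<dots> = \<zero>" using pq by simp
      finally show "(q, p) \<in> fraction_rel R S" using pq unfolding fraction_rel_def by auto
    qed
    show "trans (fraction_rel R S)"
    proof (rule transI)
      fix p q r assume "(p, q) \<in> fraction_rel R S" "(q, r) \<in> fraction_rel R S"
      then obtain a s b t u d v w where pq: "p = (a, s)" "q = (b, t)" "r = (d, v)" "a \<in> carrier R" "s \<in> S" "b \<in> carrier R" "t \<in> S"
        "u \<in> S" "d \<in> carrier R" "v \<in> S" "w \<in> S"
        and e: "u \<otimes> (a \<otimes> t \<ominus> b \<otimes> s) = \<zero>" "w \<otimes> (b \<otimes> v \<ominus> d \<otimes> t) = \<zero>" unfolding fraction_rel_def by blast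
      note c = pq(4,6,9) S[OF pq(5)] S[OF pq(7)] S[OF pq(8)] S[OF pq(10)] S[OF pq(11)]
      have "(u \<otimes> w \<otimes> t) \<otimes> (a \<otimes> v \<ominus> d \<otimes> s) =
        w \<otimes> v \<otimes> (u \<otimes> (a \<otimes> t \<ominus> b \<otimes> s)) \<oplus> u \<otimes> s \<otimes> (w \<otimes> (b \<otimes> v \<ominus> d \<otimes> t))" using c by algebra
      also have "\<dots> = \<zero>" unfolding e using c by simp
      finally show "(p, r) \<in> fraction_rel R S" using pq unfolding fraction_rel_def by auto
    qed
  qed
qed

lemma fraction_eq_iff:
  assumes "submonoid S R" "a \<in> carrier R" "s \<in> S" "b \<in> carrier R" "t \<in> S"
  shows "fraction R S a s = fraction R S b t \<longleftrightarrow> (\<exists>u\<in>S. u \<otimes> (a \<otimes> t \<ominus> b \<otimes> s) = \<zero>)"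
  unfolding fraction_def using eq_equiv_class_iff[OF fraction_rel_equiv[OF assms(1)], of "(a,s)" "(b,t)"] assms(2-)
  by (auto simp: fraction_rel_def)

lemma localization_mult_fraction:
  assumes "submonoid S R" "a \<in> carrier R" "s \<in> S" "b \<in> carrier R" "t \<in> S"
  shows "fraction R S a s \<otimes>\<^bsub>localization R S\<^esub> fraction R S b t = fraction R S (a \<otimes> b) (s \<otimes> t)"
proof -
  interpret S: submonoid S R by fact
  have S: "\<And>s. s \<in> S \<Longrightarrow> s \<in> carrier R" using S.subset by auto
  have 1: "fraction R S (a' \<otimes> b') (s' \<otimes> t') = fraction R S (a \<otimes> b) (s \<otimes> t)"
    if "(a', s') \<in> fraction R S a s" "(b', t') \<in> fraction R S b t" for a' s' b' t'
  proof -
    from that obtain u w where m: "a' \<in> carrier R" "s' \<in> S" "b' \<in> carrier R" "t' \<in> S" "u \<in> S" "w \<in> S"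
      and e: "u \<otimes> (a \<otimes> s' \<ominus> a' \<otimes> s) = \<zero>" "w \<otimes> (b \<otimes> t' \<ominus> b' \<otimes> t) = \<zero>"
      unfolding fraction_def fraction_rel_def by auto
    note c = assms(2,4) S[OF assms(3)] S[OF assms(5)] m(1,3) S[OF m(2)] S[OF m(4)] S[OF m(5)] S[OF m(6)]
    have "(u \<otimes> w) \<otimes> ((a' \<otimes> b') \<otimes> (s \<otimes> t) \<ominus> (a \<otimes> b) \<otimes> (s' \<otimes> t')) =
      \<ominus> (w \<otimes> b' \<otimes> t \<otimes> (u \<otimes> (a \<otimes> s' \<ominus> a' \<otimes> s))) \<ominus> u \<otimes> a \<otimes> s' \<otimes> (w \<otimes> (b \<otimes> t' \<ominus> b' \<otimes> t))"
      using c by algebra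
    also have "\<dots> = \<zero>" unfolding e using c by (simp add: minus_eq)
    finally show ?thesis using assms m by (subst fraction_eq_iff) auto
  qed
  have "(a, s) \<in> fraction R S a s" "(b, t) \<in> fraction R S b t"
    unfolding fraction_def by (rule equiv_class_self[OF fraction_rel_equiv[OF assms(1)]], use assms in simp)+
  note self = this
  show ?thesis
  proof (intro equalityI subsetI)
    fix z assume "z \<in> fraction R S a s \<otimes>\<^bsub>localization R S\<^esub> fraction R S b t"
    then obtain a' s' b' t' where "(a', s') \<in> fraction R S a s" "(b', t') \<in> fraction R S b t"
      "z \<in> fraction R S (a' \<otimes> b') (s' \<otimes> t')" unfolding localization_def by auto
    with 1 show "z \<in> fraction R S (a \<otimes> b) (s \<otimes> t)" by simp
  next
    fix z assume "z \<in> fraction R S (a \<otimes> b) (s \<otimes> t)"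
    with self show "z \<in> fraction R S a s \<otimes>\<^bsub>localization R S\<^esub> fraction R S b t"
      unfolding localization_def by (simp add: case_prod_unfold) (rule bexI[of _ "(a, s)"], rule bexI[of _ "(b, t)"], simp_all)
  qed
qed

lemma localization_add_fraction:
  assumes "submonoid S R" "a \<in> carrier R" "s \<in> S" "b \<in> carrier R" "t \<in> S"
  shows "fraction R S a s \<oplus>\<^bsub>localization R S\<^esub> fraction R S b t =
    fraction R S (a \<otimes> t \<oplus> b \<otimes> s) (s \<otimes> t)"
proof -
  interpret S: submonoid S R by fact
  have S: "\<And>s. s \<in> S \<Longrightarrow> s \<in> carrier R" using S.subset by auto
  have 1: "fraction R S (a' \<otimes> t' \<oplus> b' \<otimes> s') (s' \<otimes> t') = fraction R S (a \<otimes> t \<oplus> b \<otimes> s) (s \<otimes> t)"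
    if "(a', s') \<in> fraction R S a s" "(b', t') \<in> fraction R S b t" for a' s' b' t'
  proof -
    from that obtain u w where m: "a' \<in> carrier R" "s' \<in> S" "b' \<in> carrier R" "t' \<in> S" "u \<in> S" "w \<in> S"
      and e: "u \<otimes> (a \<otimes> s' \<ominus> a' \<otimes> s) = \<zero>" "w \<otimes> (b \<otimes> t' \<ominus> b' \<otimes> t) = \<zero>"
      unfolding fraction_def fraction_rel_def by auto
    note c = assms(2,4) S[OF assms(3)] S[OF assms(5)] m(1,3) S[OF m(2)] S[OF m(4)] S[OF m(5)] S[OF m(6)]
    have "(u \<otimes> w) \<otimes> ((a' \<otimes> t' \<oplus> b' \<otimes> s') \<otimes> (s \<otimes> t) \<ominus> (a \<otimes> t \<oplus> b \<otimes> s) \<otimes> (s' \<otimes> t')) =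
      \<ominus> (w \<otimes> t' \<otimes> t \<otimes> (u \<otimes> (a \<otimes> s' \<ominus> a' \<otimes> s))) \<ominus> u \<otimes> s \<otimes> s' \<otimes> (w \<otimes> (b \<otimes> t' \<ominus> b' \<otimes> t))"
      using c by algebra
    also have "\<dots> = \<zero>" unfolding e using c by (simp add: minus_eq)
    finally show ?thesis using assms m S by (subst fraction_eq_iff) auto
  qed
  have "(a, s) \<in> fraction R S a s" "(b, t) \<in> fraction R S b t"
    unfolding fraction_def by (rule equiv_class_self[OF fraction_rel_equiv[OF assms(1)]], use assms in simp)+
  note self = this
  show ?thesis
  proof (intro equalityI subsetI)
    fix z assume "z \<in> fraction R S a s \<oplus>\<^bsub>localization R S\<^esub> fraction R S b t"
    then obtain a' s' b' t' where "(a', s') \<in> fraction R S a s" "(b', t') \<in> fraction R S b t"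
      "z \<in> fraction R S (a' \<otimes> t' \<oplus> b' \<otimes> s') (s' \<otimes> t')" unfolding localization_def by auto
    with 1 show "z \<in> fraction R S (a \<otimes> t \<oplus> b \<otimes> s) (s \<otimes> t)" by simp
  next
    fix z assume "z \<in> fraction R S (a \<otimes> t \<oplus> b \<otimes> s) (s \<otimes> t)"
    with self show "z \<in> fraction R S a s \<oplus>\<^bsub>localization R S\<^esub> fraction R S b t"
      unfolding localization_def by (simp add: case_prod_unfold) (rule bexI[of _ "(a, s)"], rule bexI[of _ "(b, t)"], simp_all)
  qed
qed

lemma localization_cring:
  assumes "submonoid S R"
  shows "cring (localization R S)"
proof -
  interpret S: submonoid S R by fact
  let ?L = "localization R S"
  have S[simp]: "\<And>s. s \<in> S \<Longrightarrow> s \<in> carrier R" using S.subset by auto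
  have car: "carrier ?L = {fraction R S a s | a s. a \<in> carrier R \<and> s \<in> S}"
    by (auto simp: localization_def quotient_def fraction_def)
  have one: "\<one>\<^bsub>?L\<^esub> = fraction R S \<one> \<one>" and zero: "\<zero>\<^bsub>?L\<^esub> = fraction R S \<zero> \<one>"
    by (simp_all add: localization_def)
  note sm = localization_mult_fraction[OF assms] localization_add_fraction[OF assms]
  have eqI: "fraction R S a s = fraction R S b t" if "a \<in> carrier R" "s \<in> S" "b \<in> carrier R" "t \<in> S" "a \<otimes> t = b \<otimes> s" for a s b t
    using that by (subst fraction_eq_iff[OF assms]) (auto simp: r_neg minus_eq intro!: bexI[of _ \<one>])
  have E: "\<exists>a s. a \<in> carrier R \<and> s \<in> S \<and> x = fraction R S a s" if "x \<in> carrier ?L" for x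
    using that unfolding car by auto
  have I: "fraction R S a s \<in> carrier ?L" if "a \<in> carrier R" "s \<in> S" for a s
    using that unfolding car by auto
  show ?thesis
  proof (rule cringI)
    show "abelian_group ?L"
    proof (rule abelian_groupI)
      fix x assume "x \<in> carrier ?L"
      then obtain a s where x: "a \<in> carrier R" "s \<in> S" "x = fraction R S a s" using E by blast
      have "fraction R S (\<ominus> a) s \<oplus>\<^bsub>?L\<^esub> x = \<zero>\<^bsub>?L\<^esub>"
        unfolding x(3) zero using x by (subst sm, simp_all) (rule eqI, auto simp: l_neg l_minus)
      then show "\<exists>y\<in>carrier ?L. y \<oplus>\<^bsub>?L\<^esub> x = \<zero>\<^bsub>?L\<^esub>" using I[OF a_inv_closed[OF x(1)] x(2)] by (rule bexI)
    next
      fix x y z assume xyz: "x \<in> carrier ?L" "y \<in> carrier ?L" "z \<in> carrier ?L"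
      obtain a s where x1: "a \<in> carrier R" "s \<in> S" "x = fraction R S a s" using E[OF xyz(1)] by blast
      obtain b t where x2: "b \<in> carrier R" "t \<in> S" "y = fraction R S b t" using E[OF xyz(2)] by blast
      obtain d v where x3: "d \<in> carrier R" "v \<in> S" "z = fraction R S d v" using E[OF xyz(3)] by blast
      note x = x1 x2 x3
      note c = x(1,4,7) S[OF x(2)] S[OF x(5)] S[OF x(8)]
      have "((a \<otimes> t \<oplus> b \<otimes> s) \<otimes> v \<oplus> d \<otimes> (s \<otimes> t)) \<otimes> (s \<otimes> (t \<otimes> v)) =
        (a \<otimes> (t \<otimes> v) \<oplus> (b \<otimes> v \<oplus> d \<otimes> t) \<otimes> s) \<otimes> (s \<otimes> t \<otimes> v)" using c by algebra
      then show "x \<oplus>\<^bsub>?L\<^esub> y \<oplus>\<^bsub>?L\<^esub> z = x \<oplus>\<^bsub>?L\<^esub> (y \<oplus>\<^bsub>?L\<^esub> z)"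
        using x S by (simp add: sm) (rule eqI, simp_all)
    next
      fix x y assume xy: "x \<in> carrier ?L" "y \<in> carrier ?L"
      obtain a s where x1: "a \<in> carrier R" "s \<in> S" "x = fraction R S a s" using E[OF xy(1)] by blast
      obtain b t where x2: "b \<in> carrier R" "t \<in> S" "y = fraction R S b t" using E[OF xy(2)] by blast
      note x = x1 x2
      from x show "x \<oplus>\<^bsub>?L\<^esub> y \<in> carrier ?L" by (simp add: sm I)
      show "x \<oplus>\<^bsub>?L\<^esub> y = y \<oplus>\<^bsub>?L\<^esub> x" using x m_comm[of s t] by (simp add: sm a_comm)
    next
      fix x assume "x \<in> carrier ?L"
      then obtain a s where x: "a \<in> carrier R" "s \<in> S" "x = fraction R S a s" using E by blast
      then show "\<zero>\<^bsub>?L\<^esub> \<oplus>\<^bsub>?L\<^esub> x = x" by (simp add: sm zero)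
    next
      show "\<zero>\<^bsub>?L\<^esub> \<in> carrier ?L" by (simp add: zero I)
    qed
    show "comm_monoid ?L"
    proof (rule comm_monoidI)
      fix x y z assume xyz: "x \<in> carrier ?L" "y \<in> carrier ?L" "z \<in> carrier ?L"
      obtain a s where x1: "a \<in> carrier R" "s \<in> S" "x = fraction R S a s" using E[OF xyz(1)] by blast
      obtain b t where x2: "b \<in> carrier R" "t \<in> S" "y = fraction R S b t" using E[OF xyz(2)] by blast
      obtain d v where x3: "d \<in> carrier R" "v \<in> S" "z = fraction R S d v" using E[OF xyz(3)] by blast
      note x = x1 x2 x3
      from x show "x \<otimes>\<^bsub>?L\<^esub> y \<otimes>\<^bsub>?L\<^esub> z = x \<otimes>\<^bsub>?L\<^esub> (y \<otimes>\<^bsub>?L\<^esub> z)" by (simp add: sm m_assoc)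
    next
      fix x y assume xy: "x \<in> carrier ?L" "y \<in> carrier ?L"
      obtain a s where x1: "a \<in> carrier R" "s \<in> S" "x = fraction R S a s" using E[OF xy(1)] by blast
      obtain b t where x2: "b \<in> carrier R" "t \<in> S" "y = fraction R S b t" using E[OF xy(2)] by blast
      note x = x1 x2
      from x show "x \<otimes>\<^bsub>?L\<^esub> y \<in> carrier ?L" by (simp add: sm I)
      show "x \<otimes>\<^bsub>?L\<^esub> y = y \<otimes>\<^bsub>?L\<^esub> x" using x by (simp add: sm m_comm)
    next
      fix x assume "x \<in> carrier ?L"
      then obtain a s where x: "a \<in> carrier R" "s \<in> S" "x = fraction R S a s" using E by blast
      then show "\<one>\<^bsub>?L\<^esub> \<otimes>\<^bsub>?L\<^esub> x = x" by (simp add: sm one)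
    next
      show "\<one>\<^bsub>?L\<^esub> \<in> carrier ?L" by (simp add: one I)
    qed
      fix x y z assume xyz: "x \<in> carrier ?L" "y \<in> carrier ?L" "z \<in> carrier ?L"
      obtain a s where x1: "a \<in> carrier R" "s \<in> S" "x = fraction R S a s" using E[OF xyz(1)] by blast
      obtain b t where x2: "b \<in> carrier R" "t \<in> S" "y = fraction R S b t" using E[OF xyz(2)] by blast
      obtain d v where x3: "d \<in> carrier R" "v \<in> S" "z = fraction R S d v" using E[OF xyz(3)] by blast
      note x = x1 x2 x3
    note c = x(1,4,7) S[OF x(2)] S[OF x(5)] S[OF x(8)]
    have "((a \<otimes> t \<oplus> b \<otimes> s) \<otimes> d) \<otimes> ((s \<otimes> v) \<otimes> (t \<otimes> v)) =
      ((a \<otimes> d) \<otimes> (t \<otimes> v) \<oplus> (b \<otimes> d) \<otimes> (s \<otimes> v)) \<otimes> (s \<otimes> t \<otimes> v)" using c by algebra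
    then show "(x \<oplus>\<^bsub>?L\<^esub> y) \<otimes>\<^bsub>?L\<^esub> z = x \<otimes>\<^bsub>?L\<^esub> z \<oplus>\<^bsub>?L\<^esub> y \<otimes>\<^bsub>?L\<^esub> z"
      using x S by (simp add: sm) (rule eqI, simp_all)
  qed
qed

end

lemma (in primeideal) complement_submonoid: "submonoid (carrier R - I) R"
  by (rule submonoid.intro) (use I_prime I_notcarr one_imp_carrier in auto)

definition locally_domain :: "('a, 'm) ring_scheme \<Rightarrow> bool"
  where "locally_domain A \<longleftrightarrow>
    (\<forall>P. primeideal P A \<longrightarrow> domain (localization A (carrier A - P)))"


section \<open>Krull dimension\<close>

text \<open>The zero ring has no prime ideal; here its dimension is \<open>0\<close>, in any case finite.\<close>

definition krull_dim :: "('a, 'm) ring_scheme \<Rightarrow> enat"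
  where "krull_dim A =
    Sup {enat n | n. \<exists>P :: nat \<Rightarrow> 'a set. (\<forall>i\<le>n. primeideal (P i) A) \<and> (\<forall>i<n. P i \<subset> P (Suc i))}"


section \<open>Finite conductor rings and conductor squares\<close>

definition two_generated :: "('a, 'm) ring_scheme \<Rightarrow> 'a set \<Rightarrow> bool"
  where "two_generated R I \<longleftrightarrow> (\<exists>a\<in>carrier R. \<exists>b\<in>carrier R. I = Idl\<^bsub>R\<^esub> {a, b})"

definition finite_conductor_ring :: "('a, 'm) ring_scheme \<Rightarrow> bool"
  where "finite_conductor_ring R \<longleftrightarrow> cring R \<and>
    (\<forall>I. two_generated R I \<longrightarrow> finitely_presented R (mult_module R I))"

text \<open>The subring \<open>R\<close> of \<open>T\<close> is given by its carrier; as a ring it is \<open>T\<lparr>carrier := R\<rparr>\<close>.\<close>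

definition common_ideal :: "('a, 'm) ring_scheme \<Rightarrow> 'a set \<Rightarrow> 'a set \<Rightarrow> bool"
  where "common_ideal T R J \<longleftrightarrow> ideal J (T\<lparr>carrier := R\<rparr>) \<and> ideal J T"

locale conductor_square = cring T for T (structure) +
  fixes R C :: "'a set"
  assumes subcring: "subcring R T"
    and nonzero_common_ideal: "\<exists>J. common_ideal T R J \<and> J \<noteq> {\<zero>}"
    and conductor_common: "common_ideal T R C"
    and conductor_largest: "common_ideal T R J \<Longrightarrow> J \<subseteq> C"

locale regular_conductor_square = conductor_square +
  assumes regular: "\<exists>c\<in>C. \<forall>t\<in>carrier T. c \<otimes> t = \<zero> \<longrightarrow> t = \<zero>"

end

theory Submission
  imports Defs
begin

text \<open>The hypotheses make \<open>T\<close> a Bezout domain: a non-zero pair \<open>x, y\<close> in \<open>R\<close> satisfies \<open>r x = s u\<close>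
  and \<open>r y = s v\<close> with \<open>r\<close> a unit of \<open>T\<close>, \<open>s \<noteq> 0\<close> and \<open>(u, v)T = T\<close>. So \<open>T\<close> is always a finite
  conductor ring, and over \<open>R\<close> only the relations on unimodular pairs matter. Since \<open>C = uC + vC\<close>,
  these map onto the relations on the images of \<open>u, v\<close> in \<open>A\<close>, and the kernel is \<open>C(v, -u)\<close>; hence
  the conductor property descends from \<open>A\<close> to \<open>R\<close>. For the converse \<open>(x, y)\<close> has the same relations
  over \<open>A\<close> as \<open>(su, sv)\<close>, so it suffices that the annihilator of \<open>s\<close> in \<open>A\<close> is generated by an
  idempotent. Applying the first step to \<open>s\<close> and a generator of \<open>C\<close> gives \<open>w \<in> A\<close> with
  \<open>sw = 0\<close> such that \<open>wB\<close> is the annihilator of \<open>s\<close> in \<open>B\<close>. As \<open>A\<close> is locally a domain,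
  \<open>sw = 0\<close> gives \<open>1 = e + e'\<close> with \<open>es = 0 = e'w\<close>; every \<open>z\<close> with \<open>zs = 0\<close> lies in \<open>wB\<close>, so
  \<open>e'z = 0\<close> and \<open>z = ez\<close>.\<close>

section \<open>Ideals and primes\<close>

context cring begin

lemma genideal_pair:
  assumes "a \<in> carrier R" "b \<in> carrier R"
  shows "Idl {a, b} = {p \<otimes> a \<oplus> q \<otimes> b | p q. p \<in> carrier R \<and> q \<in> carrier R}"
proof (intro equalityI subsetI)
  have s: "{a, b} \<subseteq> carrier R" using assms by simp
  interpret I: ideal "Idl {a, b}" R by (rule genideal_ideal[OF s])
  have ab: "a \<in> Idl {a, b}" "b \<in> Idl {a, b}" using genideal_self[OF s] by auto
  {
    fix x assume "x \<in> {p \<otimes> a \<oplus> q \<otimes> b | p q. p \<in> carrier R \<and> q \<in> carrier R}"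
    then show "x \<in> Idl {a, b}" using ab by (auto intro!: I.I_l_closed)
  }
  have "PIdl a <+> PIdl b = {p \<otimes> a \<oplus> q \<otimes> b | p q. p \<in> carrier R \<and> q \<in> carrier R}"
    by (auto simp: set_add_def' cgenideal_def)
  moreover have "ideal (PIdl a <+> PIdl b) R"
    using add_ideals cgenideal_ideal assms by blast
  ultimately have "ideal {p \<otimes> a \<oplus> q \<otimes> b | p q. p \<in> carrier R \<and> q \<in> carrier R} R" by simp
  moreover have "a \<in> {p \<otimes> a \<oplus> q \<otimes> b | p q. p \<in> carrier R \<and> q \<in> carrier R}"
    using assms by simp (metis l_null l_one one_closed r_zero zero_closed)
  moreover have "b \<in> {p \<otimes> a \<oplus> q \<otimes> b | p q. p \<in> carrier R \<and> q \<in> carrier R}"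
    using assms by simp (metis l_null l_one one_closed l_zero zero_closed)
  ultimately have "Idl {a, b} \<subseteq> {p \<otimes> a \<oplus> q \<otimes> b | p q. p \<in> carrier R \<and> q \<in> carrier R}"
    by (intro genideal_minimal) auto
  then show "x \<in> {p \<otimes> a \<oplus> q \<otimes> b | p q. p \<in> carrier R \<and> q \<in> carrier R}" if "x \<in> Idl {a, b}" for x
    using that by blast
qed

section \<open>Prime ideals and annihilators\<close>

text \<open>Zorn's lemma applies to the ideals that contain \<open>J\<close> and avoid
  \<open>\<one>\<close>, since the union of a non-empty chain of them is again one; a maximal such
  ideal is a maximal ideal and hence prime.\<close>

lemma ex_primeideal_superset:
  assumes "ideal J R" "\<one> \<notin> J"
  shows "\<exists>P. primeideal P R \<and> J \<subseteq> P"
proof -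
  define S where "S = {I. ideal I R \<and> J \<subseteq> I \<and> \<one> \<notin> I}"
  have "\<exists>M\<in>S. \<forall>Y\<in>S. M \<subseteq> Y \<longrightarrow> Y = M"
  proof (rule subset_Zorn)
    fix K assume K: "subset.chain S K"
    show "\<exists>U\<in>S. \<forall>Y\<in>K. Y \<subseteq> U"
    proof (cases "K = {}")
      case True
      then show ?thesis using assms by (auto simp: S_def)
    next
      case False
      have KS: "K \<subseteq> S" using K by (auto simp: pred_on.chain_def)
      then have "subset.chain {I. ideal I R} K"
        using K by (auto simp: pred_on.chain_def S_def)
      then have "ideal (\<Union>K) R" using chain_Union_is_ideal[of K] False by simp
      then have "\<Union>K \<in> S" using KS False by (auto simp: S_def)
      then show ?thesis by blast
    qed
  qed
  then obtain M where M: "M \<in> S" "\<And>Y. Y \<in> S \<Longrightarrow> M \<subseteq> Y \<Longrightarrow> Y = M" by blast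
  then have MI: "ideal M R" "J \<subseteq> M" "\<one> \<notin> M" by (auto simp: S_def)
  have "maximalideal M R"
  proof (rule maximalidealI[OF MI(1)])
    show "carrier R \<noteq> M" using MI by auto
    fix Y assume Y: "ideal Y R" "M \<subseteq> Y" "Y \<subseteq> carrier R"
    show "Y = M \<or> Y = carrier R"
      using M(2)[of Y] Y MI ideal.one_imp_carrier[OF Y(1)] by (auto simp: S_def)
  qed
  then show ?thesis using MI maximalideal_prime by blast
qed

lemma annihilator_ideal:
  assumes c: "c \<in> carrier R"
  shows "ideal {x \<in> carrier R. x \<otimes> c = \<zero>} R" (is "ideal ?J R")
proof (rule idealI)
  show "subgroup ?J (add_monoid R)"
    by (rule add.subgroupI) (use c in \<open>auto simp: l_distr l_minus intro: exI[of _ \<zero>]\<close>)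
next
  fix x y assume "x \<in> ?J" "y \<in> carrier R"
  then have xy: "x \<in> carrier R" "x \<otimes> c = \<zero>" "y \<in> carrier R" by auto
  then have "(y \<otimes> x) \<otimes> c = \<zero>" using c by (simp add: m_assoc)
  then show "y \<otimes> x \<in> ?J" "x \<otimes> y \<in> ?J" using xy m_comm by auto
qed (rule ring_axioms)

text \<open>If the sum of the annihilators of \<open>a\<close> and \<open>b\<close> were proper, it
  would lie in a prime \<open>P\<close>. Nothing outside \<open>P\<close> then kills
  \<open>a\<close> or \<open>b\<close>, so both are non-zero in the localization at
  \<open>P\<close>, where their product is zero; this contradicts integrality there.\<close>

lemma locally_domain_comaximal:
  assumes "locally_domain R" "a \<in> carrier R" "b \<in> carrier R" "a \<otimes> b = \<zero>"
  shows "\<exists>x\<in>carrier R. \<exists>y\<in>carrier R. x \<oplus> y = \<one> \<and> x \<otimes> a = \<zero> \<and> y \<otimes> b = \<zero>"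
proof (rule ccontr)
  assume no: "\<not> ?thesis"
  define ann where "ann = (\<lambda>c. {x \<in> carrier R. x \<otimes> c = \<zero>})"
  have ann: "ideal (ann c) R" if "c \<in> carrier R" for c
    unfolding ann_def by (rule annihilator_ideal[OF that])
  have J: "ideal (ann a <+> ann b) R" using add_ideals ann assms by blast
  have "\<one> \<notin> ann a <+> ann b" using no by (auto simp: set_add_def' ann_def)
  then obtain P where P: "primeideal P R" "set_add R (ann a) (ann b) \<subseteq> P"
    using ex_primeideal_superset[OF J] by blast
  interpret P: primeideal P R by fact
  have sub: "ann a \<subseteq> P" "ann b \<subseteq> P"
  proof -
    have z: "\<zero> \<in> ann a" "\<zero> \<in> ann b" using assms by (auto simp: ann_def)
    show "ann a \<subseteq> P"
    proof
      fix x assume x: "x \<in> ann a"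
      then have "x \<oplus> \<zero> \<in> ann a <+> ann b" using z unfolding set_add_def' by blast
      then show "x \<in> P" using x P(2) by (auto simp: ann_def)
    qed
    show "ann b \<subseteq> P"
    proof
      fix x assume x: "x \<in> ann b"
      then have "\<zero> \<oplus> x \<in> ann a <+> ann b" using z unfolding set_add_def' by blast
      then show "x \<in> P" using x P(2) by (auto simp: ann_def)
    qed
  qed
  let ?S = "carrier R - P"
  let ?L = "localization R ?S"
  note S = P.complement_submonoid
  interpret L: domain ?L using assms(1) P(1) by (auto simp: locally_domain_def)
  have one: "\<one> \<in> ?S" using submonoid.one_closed[OF S] .
  have car: "fraction R ?S c \<one> \<in> carrier ?L" if "c \<in> carrier R" for c
    using that one by (auto simp: localization_def quotient_def fraction_def)
  have ne: "fraction R ?S c \<one> \<noteq> \<zero>\<^bsub>?L\<^esub>" if c: "c \<in> carrier R" "ann c \<subseteq> P" for c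
  proof
    assume "fraction R ?S c \<one> = \<zero>\<^bsub>?L\<^esub>"
    then have "fraction R ?S c \<one> = fraction R ?S \<zero> \<one>" by (simp add: localization_def)
    then obtain u where u: "u \<in> ?S" "u \<otimes> (c \<otimes> \<one> \<ominus> \<zero> \<otimes> \<one>) = \<zero>"
      using fraction_eq_iff[OF S c(1) one zero_closed one] by blast
    then have "u \<in> ann c" using c(1) by (simp add: ann_def minus_eq)
    with c(2) u show False by blast
  qed
  have "fraction R ?S a \<one> \<otimes>\<^bsub>?L\<^esub> fraction R ?S b \<one> = \<zero>\<^bsub>?L\<^esub>"
    using localization_mult_fraction[OF S assms(2) one assms(3) one] assms(4)
    by (simp add: localization_def)
  then show False
    using L.integral[OF _ car[OF assms(2)] car[OF assms(3)]] ne[OF assms(2) sub(1)] ne[OF assms(3) sub(2)]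
    by simp
qed

end

section \<open>Finitely presented two-generated ideals\<close>

definition syzygies :: "('a, 'm) ring_scheme \<Rightarrow> 'a \<Rightarrow> 'a \<Rightarrow> ('a \<times> 'a) set"
  where "syzygies R a b =
    {(x, y). x \<in> carrier R \<and> y \<in> carrier R \<and> x \<otimes>\<^bsub>R\<^esub> a \<oplus>\<^bsub>R\<^esub> y \<otimes>\<^bsub>R\<^esub> b = \<zero>\<^bsub>R\<^esub>}"

definition pair_submodule :: "('a, 'm) ring_scheme \<Rightarrow> ('a \<times> 'a) set \<Rightarrow> bool"
  where "pair_submodule R N \<longleftrightarrow> N \<subseteq> carrier R \<times> carrier R \<and> (\<zero>\<^bsub>R\<^esub>, \<zero>\<^bsub>R\<^esub>) \<in> N \<and>
    (\<forall>x y x' y'. (x, y) \<in> N \<longrightarrow> (x', y') \<in> N \<longrightarrow> (x \<oplus>\<^bsub>R\<^esub> x', y \<oplus>\<^bsub>R\<^esub> y') \<in> N) \<and>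
    (\<forall>k\<in>carrier R. \<forall>x y. (x, y) \<in> N \<longrightarrow> (k \<otimes>\<^bsub>R\<^esub> x, k \<otimes>\<^bsub>R\<^esub> y) \<in> N)"

text \<open>Generation by \<open>S\<close> is expressed by testing against all submodules of pairs,
  so that no explicit linear combinations occur and membership is proved through closure properties
  of a suitable \<open>N\<close>.\<close>

definition syzygies_fg :: "('a, 'm) ring_scheme \<Rightarrow> 'a \<Rightarrow> 'a \<Rightarrow> bool"
  where "syzygies_fg R a b \<longleftrightarrow> (\<exists>S. finite S \<and> S \<subseteq> syzygies R a b \<and>
    (\<forall>N. pair_submodule R N \<longrightarrow> S \<subseteq> N \<longrightarrow> syzygies R a b \<subseteq> N))"

lemma pair_submoduleD:
  assumes "pair_submodule R N"
  shows "N \<subseteq> carrier R \<times> carrier R" "(\<zero>\<^bsub>R\<^esub>, \<zero>\<^bsub>R\<^esub>) \<in> N"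
    "\<And>x y x' y'. (x, y) \<in> N \<Longrightarrow> (x', y') \<in> N \<Longrightarrow> (x \<oplus>\<^bsub>R\<^esub> x', y \<oplus>\<^bsub>R\<^esub> y') \<in> N"
    "\<And>k x y. k \<in> carrier R \<Longrightarrow> (x, y) \<in> N \<Longrightarrow> (k \<otimes>\<^bsub>R\<^esub> x, k \<otimes>\<^bsub>R\<^esub> y) \<in> N"
  using assms unfolding pair_submodule_def by auto

definition unit_vec :: "('a, 'm) ring_scheme \<Rightarrow> nat \<Rightarrow> nat \<Rightarrow> nat \<Rightarrow> 'a"
  where "unit_vec R n i = (\<lambda>j\<in>{..<n}. if j = i then \<one>\<^bsub>R\<^esub> else \<zero>\<^bsub>R\<^esub>)"

text \<open>The linear form on \<open>free_module R n\<close> with value \<open>f i\<close> at the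
  \<open>i\<close>-th unit vector; maps into pairs are given by two of them.\<close>

definition lin_comb :: "('a, 'm) ring_scheme \<Rightarrow> nat \<Rightarrow> (nat \<Rightarrow> 'a) \<Rightarrow> (nat \<Rightarrow> 'a) \<Rightarrow> 'a"
  where "lin_comb R n f x = (\<Oplus>\<^bsub>R\<^esub>i\<in>{..<n}. x i \<otimes>\<^bsub>R\<^esub> f i)"

context cring begin

lemma unit_vec_carrier: "unit_vec R n i \<in> carrier (free_module R n)"
  by (auto simp: unit_vec_def free_module_def)

text \<open>Truncating \<open>x\<close> after its first \<open>k\<close> coordinates gives
  \<open>t k\<close>; passing from \<open>t k\<close> to \<open>t (Suc k)\<close> adds a multiple of
  one unit vector, so induction on \<open>k\<close> reaches \<open>x\<close>.\<close>

lemma free_module_induct [consumes 1, case_names zero add smult unit]: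
  assumes x: "x \<in> carrier (free_module R n)"
    and zero: "Q \<zero>\<^bsub>free_module R n\<^esub>"
    and add: "\<And>x y. x \<in> carrier (free_module R n) \<Longrightarrow> y \<in> carrier (free_module R n) \<Longrightarrow>
      Q x \<Longrightarrow> Q y \<Longrightarrow> Q (x \<oplus>\<^bsub>free_module R n\<^esub> y)"
    and smult: "\<And>k x. k \<in> carrier R \<Longrightarrow> x \<in> carrier (free_module R n) \<Longrightarrow>
      Q x \<Longrightarrow> Q (k \<odot>\<^bsub>free_module R n\<^esub> x)"
    and unit: "\<And>i. i < n \<Longrightarrow> Q (unit_vec R n i)"
  shows "Q x"
proof -
  interpret F: module R "free_module R n" by (rule module_free[OF is_cring])
  have xc: "x i \<in> carrier R" if "i < n" for i using x that by (auto simp: free_module_def)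
  define t where "t = (\<lambda>k. \<lambda>i\<in>{..<n}. if i < k then x i else \<zero>)"
  have tc: "t k \<in> carrier (free_module R n)" for k
    using xc by (auto simp: free_module_def t_def)
  have "k \<le> n \<Longrightarrow> Q (t k)" for k
  proof (induction k)
    case 0
    have "t 0 = \<zero>\<^bsub>free_module R n\<^esub>" by (simp add: t_def free_module_def)
    then show ?case using zero by simp
  next
    case (Suc k)
    have "t (Suc k) = t k \<oplus>\<^bsub>free_module R n\<^esub> (x k \<odot>\<^bsub>free_module R n\<^esub> unit_vec R n k)"
      using xc Suc.prems by (auto simp: t_def free_module_def unit_vec_def fun_eq_iff less_Suc_eq)
    then show ?case
      using Suc tc xc[of k] unit_vec_carrier by (auto intro!: add smult unit)
  qed
  moreover have "t n = x"
    using x by (auto simp: t_def free_module_def fun_eq_iff PiE_def extensional_def)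
  ultimately show ?thesis by blast
qed

lemma lin_comb:
  assumes f: "f ` {..<n} \<subseteq> carrier R"
  shows lin_comb_closed: "x \<in> carrier (free_module R n) \<Longrightarrow> lin_comb R n f x \<in> carrier R"
    and lin_comb_add: "x \<in> carrier (free_module R n) \<Longrightarrow> y \<in> carrier (free_module R n) \<Longrightarrow>
      lin_comb R n f (x \<oplus>\<^bsub>free_module R n\<^esub> y) = lin_comb R n f x \<oplus> lin_comb R n f y"
    and lin_comb_smult: "k \<in> carrier R \<Longrightarrow> x \<in> carrier (free_module R n) \<Longrightarrow>
      lin_comb R n f (k \<odot>\<^bsub>free_module R n\<^esub> x) = k \<otimes> lin_comb R n f x"
    and lin_comb_zero: "lin_comb R n f \<zero>\<^bsub>free_module R n\<^esub> = \<zero>"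
    and lin_comb_unit: "i < n \<Longrightarrow> lin_comb R n f (unit_vec R n i) = f i"
proof -
  have f: "f i \<in> carrier R" if "i < n" for i using f that by auto
  have xc: "x i \<in> carrier R" if "x \<in> carrier (free_module R n)" "i < n" for x i
    using that by (auto simp: free_module_def)
  show "lin_comb R n f x \<in> carrier R" if "x \<in> carrier (free_module R n)"
    unfolding lin_comb_def using that f xc by (auto intro!: finsum_closed)
  show "lin_comb R n f (x \<oplus>\<^bsub>free_module R n\<^esub> y) = lin_comb R n f x \<oplus> lin_comb R n f y"
    if "x \<in> carrier (free_module R n)" "y \<in> carrier (free_module R n)"
  proof -
    have "lin_comb R n f (x \<oplus>\<^bsub>free_module R n\<^esub> y) = (\<Oplus>i\<in>{..<n}. x i \<otimes> f i \<oplus> y i \<otimes> f i)"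
      unfolding lin_comb_def using that f xc
      by (intro finsum_cong') (auto simp: l_distr free_module_def)
    also have "\<dots> = lin_comb R n f x \<oplus> lin_comb R n f y"
      unfolding lin_comb_def using that f xc by (intro finsum_addf) auto
    finally show ?thesis .
  qed
  show "lin_comb R n f (k \<odot>\<^bsub>free_module R n\<^esub> x) = k \<otimes> lin_comb R n f x"
    if "k \<in> carrier R" "x \<in> carrier (free_module R n)"
  proof -
    have "lin_comb R n f (k \<odot>\<^bsub>free_module R n\<^esub> x) = (\<Oplus>i\<in>{..<n}. k \<otimes> (x i \<otimes> f i))"
      unfolding lin_comb_def using that f xc
      by (intro finsum_cong') (auto simp: m_assoc free_module_def)
    also have "\<dots> = k \<otimes> lin_comb R n f x"
      unfolding lin_comb_def using that f xc by (intro finsum_rdistr[symmetric]) auto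
    finally show ?thesis .
  qed
  have "lin_comb R n f \<zero>\<^bsub>free_module R n\<^esub> = (\<Oplus>i\<in>{..<n}. \<zero>)"
    unfolding lin_comb_def using f by (intro finsum_cong') (auto simp: free_module_def)
  then show "lin_comb R n f \<zero>\<^bsub>free_module R n\<^esub> = \<zero>" by simp
  have "lin_comb R n f (unit_vec R n i) = (\<Oplus>j\<in>{..<n}. if i = j then f j else \<zero>)"
    unfolding lin_comb_def using f by (intro finsum_cong') (auto simp: unit_vec_def)
  then show "lin_comb R n f (unit_vec R n i) = f i" if "i < n"
    using that f by (subst (asm) finsum_singleton) auto
qed

lemma module_hom_add:
  "f \<in> module_hom R M N \<Longrightarrow> x \<in> carrier M \<Longrightarrow> y \<in> carrier M \<Longrightarrow> f (x \<oplus>\<^bsub>M\<^esub> y) = f x \<oplus>\<^bsub>N\<^esub> f y"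
  and module_hom_smult:
  "f \<in> module_hom R M N \<Longrightarrow> a \<in> carrier R \<Longrightarrow> x \<in> carrier M \<Longrightarrow> f (a \<odot>\<^bsub>M\<^esub> x) = a \<odot>\<^bsub>N\<^esub> f x"
  and module_hom_closed:
  "f \<in> module_hom R M N \<Longrightarrow> x \<in> carrier M \<Longrightarrow> f x \<in> carrier N"
  by (auto simp: module_hom_def)

lemma module_hom_zero:
  assumes "module R M" "module R N" "f \<in> module_hom R M N"
  shows "f \<zero>\<^bsub>M\<^esub> = \<zero>\<^bsub>N\<^esub>"
proof -
  interpret M: module R M by fact
  interpret N: module R N by fact
  have "f (\<zero> \<odot>\<^bsub>M\<^esub> \<zero>\<^bsub>M\<^esub>) = \<zero> \<odot>\<^bsub>N\<^esub> f \<zero>\<^bsub>M\<^esub>"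
    using assms(3) by (intro module_hom_smult) auto
  then show ?thesis using module_hom_closed[OF assms(3)] by simp
qed

section \<open>Presentations of an ideal and relations on two generators\<close>

text \<open>A finite generating set of relations, listed as \<open>(f i, g i)\<close>, supplies the
  presentation: \<open>\<phi>\<close> combines \<open>a\<close> and \<open>b\<close>, and the
  columns of \<open>\<psi>\<close> are the listed relations. The image of \<open>\<psi>\<close> is a
  submodule that contains them, hence it contains the whole kernel of \<open>\<phi>\<close>.\<close>

lemma syzygies_fg_imp_fp:
  assumes ab: "a \<in> carrier R" "b \<in> carrier R" and fg: "syzygies_fg R a b"
  shows "finitely_presented R (mult_module R (Idl {a, b}))"
proof -
  obtain S where S: "finite S" "S \<subseteq> syzygies R a b"
    "\<And>N. pair_submodule R N \<Longrightarrow> S \<subseteq> N \<Longrightarrow> syzygies R a b \<subseteq> N"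
    using fg unfolding syzygies_fg_def by blast
  obtain l where l: "set l = S" using finite_list[OF S(1)] by blast
  define m where "m = length l"
  define f g where "f = (\<lambda>i. fst (l ! i))" and "g = (\<lambda>i. snd (l ! i))"
  have li: "(f i, g i) \<in> syzygies R a b" if "i < m" for i
    using that S(2) l by (auto simp: f_def g_def m_def)
  then have fgc: "f i \<in> carrier R" "g i \<in> carrier R" "f i \<otimes> a \<oplus> g i \<otimes> b = \<zero>" if "i < m" for i
    using that by (auto simp: syzygies_def)
  let ?I = "Idl {a, b}"
  let ?F = "free_module R"
  have I: "ideal ?I R" using genideal_ideal ab by auto
  have Ia: "p \<otimes> a \<oplus> q \<otimes> b \<in> ?I" if "p \<in> carrier R" "q \<in> carrier R" for p q
    using that genideal_pair[OF ab] by blast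
  define \<phi> where "\<phi> = (\<lambda>x. x 0 \<otimes> a \<oplus> x (Suc 0) \<otimes> b)"
  define \<psi>1 \<psi>2 where "\<psi>1 = lin_comb R m f" and "\<psi>2 = lin_comb R m g"
  define vec where "vec = (\<lambda>(p::'a) q. \<lambda>i\<in>{..<2::nat}. if i = 0 then p else q)"
  define \<psi> where "\<psi> = (\<lambda>x. vec (\<psi>1 x) (\<psi>2 x))"
  have xc: "x i \<in> carrier R" if "x \<in> carrier (?F m)" "i < m" for x i m
    using that by (auto simp: free_module_def)
  have xc2: "x 0 \<in> carrier R" "x (Suc 0) \<in> carrier R" if "x \<in> carrier (?F 2)" for x
    using xc[OF that] by simp_all
  have fg: "f ` {..<m} \<subseteq> carrier R" "g ` {..<m} \<subseteq> carrier R" using fgc by auto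
  note \<psi>c = lin_comb_closed[OF fg(1), folded \<psi>1_def] lin_comb_closed[OF fg(2), folded \<psi>2_def]
    and \<psi>add = lin_comb_add[OF fg(1), folded \<psi>1_def] lin_comb_add[OF fg(2), folded \<psi>2_def]
    and \<psi>sm = lin_comb_smult[OF fg(1), folded \<psi>1_def] lin_comb_smult[OF fg(2), folded \<psi>2_def]
    and \<psi>z = lin_comb_zero[OF fg(1), folded \<psi>1_def] lin_comb_zero[OF fg(2), folded \<psi>2_def]
    and \<psi>u = lin_comb_unit[OF fg(1), folded \<psi>1_def] lin_comb_unit[OF fg(2), folded \<psi>2_def]
  have vec: "vec p q \<in> carrier (?F 2)" if "p \<in> carrier R" "q \<in> carrier R" for p q
    using that by (auto simp: vec_def free_module_def)
  have vec_ex: "x = vec (x 0) (x (Suc 0))" if "x \<in> carrier (?F 2)" for x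
    using that by (auto simp: vec_def free_module_def fun_eq_iff PiE_def extensional_def less_2_cases_iff)
  have \<phi>vec: "\<phi> (vec p q) = p \<otimes> a \<oplus> q \<otimes> b" for p q by (simp add: \<phi>_def vec_def)
  interpret Fm: module R "?F m" by (rule module_free[OF is_cring])
  have im: "(\<psi>1 x, \<psi>2 x) \<in> syzygies R a b" if "x \<in> carrier (?F m)" for x
    using that
  proof (induction x rule: free_module_induct)
    case zero then show ?case using ab by (auto simp: \<psi>z syzygies_def)
  next
    case (add x y)
    then have *: "\<psi>1 x \<otimes> a \<oplus> \<psi>2 x \<otimes> b = \<zero>" "\<psi>1 y \<otimes> a \<oplus> \<psi>2 y \<otimes> b = \<zero>" by (auto simp: syzygies_def)
    have "(\<psi>1 x \<oplus> \<psi>1 y) \<otimes> a \<oplus> (\<psi>2 x \<oplus> \<psi>2 y) \<otimes> b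
      = (\<psi>1 x \<otimes> a \<oplus> \<psi>2 x \<otimes> b) \<oplus> (\<psi>1 y \<otimes> a \<oplus> \<psi>2 y \<otimes> b)"
      using \<psi>c[OF add(1)] \<psi>c[OF add(2)] ab by algebra
    then show ?case using add(1,2) \<psi>c * by (auto simp: \<psi>add syzygies_def)
  next
    case (smult k x)
    then have *: "\<psi>1 x \<otimes> a \<oplus> \<psi>2 x \<otimes> b = \<zero>" by (auto simp: syzygies_def)
    have "(k \<otimes> \<psi>1 x) \<otimes> a \<oplus> (k \<otimes> \<psi>2 x) \<otimes> b = k \<otimes> (\<psi>1 x \<otimes> a \<oplus> \<psi>2 x \<otimes> b)"
      using smult(1) \<psi>c[OF smult(2)] ab by algebra
    then show ?case using smult(1,2) \<psi>c * by (auto simp: \<psi>sm syzygies_def)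
  next
    case (unit i) then show ?case using li by (simp add: \<psi>u)
  qed
  let ?N = "(\<lambda>x. (\<psi>1 x, \<psi>2 x)) ` carrier (?F m)"
  have "pair_submodule R ?N"
    unfolding pair_submodule_def
  proof (intro conjI allI impI ballI)
    show "(\<zero>, \<zero>) \<in> ?N"
      by (rule image_eqI[OF _ Fm.zero_closed]) (simp add: \<psi>z)
  next
    fix x y x' y' assume "(x, y) \<in> ?N" "(x', y') \<in> ?N"
    then obtain z z' where z: "z \<in> carrier (?F m)" "z' \<in> carrier (?F m)"
      "(x, y) = (\<psi>1 z, \<psi>2 z)" "(x', y') = (\<psi>1 z', \<psi>2 z')" by blast
    then show "(x \<oplus> x', y \<oplus> y') \<in> ?N"
      by (intro image_eqI[OF _ Fm.a_closed[OF z(1,2)]]) (simp add: \<psi>add)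
  next
    fix k x y assume k: "k \<in> carrier R" and "(x, y) \<in> ?N"
    then obtain z where z: "z \<in> carrier (?F m)" "(x, y) = (\<psi>1 z, \<psi>2 z)" by blast
    then show "(k \<otimes> x, k \<otimes> y) \<in> ?N"
      by (intro image_eqI[OF _ Fm.smult_closed[OF k z(1)]]) (simp add: \<psi>sm k)
  qed (use \<psi>c in auto)
  moreover have "S \<subseteq> ?N"
  proof
    fix z assume "z \<in> S"
    then obtain i where i: "i < m" "z = (f i, g i)"
      using l by (auto simp: in_set_conv_nth m_def f_def g_def)
    then show "z \<in> ?N" using \<psi>u unit_vec_carrier by (intro image_eqI[of _ _ "unit_vec R m i"]) auto
  qed
  ultimately have N: "syzygies R a b \<subseteq> ?N" using S(3) by blast
  show ?thesis
    unfolding finitely_presented_def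
  proof (intro conjI exI bexI)
    show "module R (mult_module R ?I)" by (rule module_ideal[OF is_cring I])
    show "\<psi> \<in> module_hom R (?F m) (?F 2)"
    proof -
      have "vec p q \<oplus>\<^bsub>?F 2\<^esub> vec p' q' = vec (p \<oplus> p') (q \<oplus> q')" for p q p' q'
        by (auto simp: vec_def free_module_def)
      moreover have "k \<odot>\<^bsub>?F 2\<^esub> vec p q = vec (k \<otimes> p) (k \<otimes> q)" for k p q
        by (auto simp: vec_def free_module_def)
      ultimately show ?thesis
        unfolding module_hom_def by (auto simp: \<psi>_def \<psi>c \<psi>add \<psi>sm intro!: vec)
    qed
    show "\<phi> \<in> module_hom R (?F 2) (mult_module R ?I)"
    proof -
      have "(x 0 \<oplus> y 0) \<otimes> a \<oplus> (x (Suc 0) \<oplus> y (Suc 0)) \<otimes> b = (x 0 \<otimes> a \<oplus> x (Suc 0) \<otimes> b) \<oplus> (y 0 \<otimes> a \<oplus> y (Suc 0) \<otimes> b)"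
        if "x \<in> carrier (?F 2)" "y \<in> carrier (?F 2)" for x y
        using xc2[OF that(1)] xc2[OF that(2)] ab
        by algebra
      moreover have "(x \<oplus>\<^bsub>?F 2\<^esub> y) i = x i \<oplus> y i" "(k \<odot>\<^bsub>?F 2\<^esub> x) i = k \<otimes> x i" if "i < 2" for x y i k
        using that by (auto simp: free_module_def)
      moreover have "(k \<otimes> x 0) \<otimes> a \<oplus> (k \<otimes> x (Suc 0)) \<otimes> b = k \<otimes> (x 0 \<otimes> a \<oplus> x (Suc 0) \<otimes> b)"
        if "x \<in> carrier (?F 2)" "k \<in> carrier R" for x k
        using xc2[OF that(1)] that(2) ab by algebra
      ultimately show ?thesis
        by (auto simp: module_hom_def mult_module_def \<phi>_def intro!: Ia dest: xc2)
    qed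
    show "\<phi> ` carrier (?F 2) = carrier (mult_module R ?I)"
    proof (intro equalityI subsetI)
      fix z assume "z \<in> carrier (mult_module R ?I)"
      then obtain p q where "p \<in> carrier R" "q \<in> carrier R" "z = p \<otimes> a \<oplus> q \<otimes> b"
        using genideal_pair[OF ab] by (auto simp: mult_module_def)
      then show "z \<in> \<phi> ` carrier (?F 2)" using \<phi>vec vec by (metis image_eqI)
    qed (auto simp: mult_module_def \<phi>_def intro!: Ia dest: xc2)
    show "\<psi> ` carrier (?F m) = {x \<in> carrier (?F 2). \<phi> x = \<zero>\<^bsub>mult_module R ?I\<^esub>}"
    proof (intro equalityI subsetI)
      fix z assume "z \<in> \<psi> ` carrier (?F m)"
      then show "z \<in> {x \<in> carrier (?F 2). \<phi> x = \<zero>\<^bsub>mult_module R ?I\<^esub>}"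
        using im \<psi>c by (auto simp: \<psi>_def \<phi>vec mult_module_def syzygies_def intro!: vec)
    next
      fix z assume z: "z \<in> {x \<in> carrier (?F 2). \<phi> x = \<zero>\<^bsub>mult_module R ?I\<^esub>}"
      then have "(z 0, z (Suc 0)) \<in> syzygies R a b"
        using xc2[of z] by (auto simp: syzygies_def \<phi>_def mult_module_def)
      then obtain x where "x \<in> carrier (?F m)" "z 0 = \<psi>1 x" "z (Suc 0) = \<psi>2 x" using N by auto
      then show "z \<in> \<psi> ` carrier (?F m)" using vec_ex[of z] z by (auto simp: \<psi>_def)
    qed
  qed
qed

text \<open>Schanuel's lemma: the relations on \<open>a, b\<close> are generated by the images of the given relations
  on the \<open>n\<close> generators \<open>p i \<otimes> a \<oplus> q i \<otimes> b\<close> and by the two relations that express \<open>a\<close> and \<open>b\<close> through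
  these generators.\<close>

lemma fp_imp_syzygies_fg:
  assumes ab: "a \<in> carrier R" "b \<in> carrier R"
    and fp: "finitely_presented R (mult_module R (Idl {a, b}))"
  shows "syzygies_fg R a b"
proof -
  let ?I = "Idl {a, b}"
  let ?M = "mult_module R ?I"
  let ?F = "free_module R"
  obtain m n \<psi> \<phi> where M: "module R ?M"
    and \<psi>: "\<psi> \<in> module_hom R (?F m) (?F n)" and \<phi>: "\<phi> \<in> module_hom R (?F n) ?M"
    and sur: "\<phi> ` carrier (?F n) = carrier ?M"
    and ker: "\<psi> ` carrier (?F m) = {x \<in> carrier (?F n). \<phi> x = \<zero>\<^bsub>?M\<^esub>}"
    using fp unfolding finitely_presented_def by blast
  interpret Fm: module R "?F m" by (rule module_free[OF is_cring])
  interpret Fn: module R "?F n" by (rule module_free[OF is_cring])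
  have Mc: "carrier ?M = {p \<otimes> a \<oplus> q \<otimes> b | p q. p \<in> carrier R \<and> q \<in> carrier R}"
    using genideal_pair[OF ab] by (simp add: mult_module_def)
  have Mops: "x \<oplus>\<^bsub>?M\<^esub> y = x \<oplus> y" "k \<odot>\<^bsub>?M\<^esub> x = k \<otimes> x" "\<zero>\<^bsub>?M\<^esub> = \<zero>" for x y k
    by (auto simp: mult_module_def)
  note \<phi>add = module_hom_add[OF \<phi>, unfolded Mops] and \<phi>sm = module_hom_smult[OF \<phi>, unfolded Mops]
  have "\<forall>i. \<exists>p q. p \<in> carrier R \<and> q \<in> carrier R \<and> \<phi> (unit_vec R n i) = p \<otimes> a \<oplus> q \<otimes> b"
    using module_hom_closed[OF \<phi> unit_vec_carrier] Mc by blast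
  then obtain p q where pq: "\<And>i. p i \<in> carrier R" "\<And>i. q i \<in> carrier R"
    "\<And>i. \<phi> (unit_vec R n i) = p i \<otimes> a \<oplus> q i \<otimes> b" by metis
  have "\<one> \<otimes> a \<oplus> \<zero> \<otimes> b = a" "\<zero> \<otimes> a \<oplus> \<one> \<otimes> b = b" using ab by auto
  then have "a \<in> carrier ?M" "b \<in> carrier ?M"
    unfolding Mc by (metis (mono_tags, lifting) mem_Collect_eq one_closed zero_closed)+
  then have "a \<in> \<phi> ` carrier (?F n)" "b \<in> \<phi> ` carrier (?F n)" by (simp_all add: sur)
  then obtain \<alpha> \<beta> where \<alpha>\<beta>: "\<alpha> \<in> carrier (?F n)" "\<beta> \<in> carrier (?F n)" "\<phi> \<alpha> = a" "\<phi> \<beta> = b"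
    by (auto elim!: imageE)
  \<comment> \<open>Together \<open>P\<close> and \<open>Q\<close> lift \<open>\<phi>\<close> along
    the map from pairs onto the ideal; \<open>\<phi>eq\<close> below is this lifting
    property.\<close>
  define P Q where "P = lin_comb R n p" and "Q = lin_comb R n q"
  have pqi: "p ` {..<n} \<subseteq> carrier R" "q ` {..<n} \<subseteq> carrier R" using pq by auto
  note PQc = lin_comb_closed[OF pqi(1), folded P_def] lin_comb_closed[OF pqi(2), folded Q_def]
    and PQadd = lin_comb_add[OF pqi(1), folded P_def] lin_comb_add[OF pqi(2), folded Q_def]
    and PQsm = lin_comb_smult[OF pqi(1), folded P_def] lin_comb_smult[OF pqi(2), folded Q_def]
    and PQz = lin_comb_zero[OF pqi(1), folded P_def] lin_comb_zero[OF pqi(2), folded Q_def]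
    and PQu = lin_comb_unit[OF pqi(1), folded P_def] lin_comb_unit[OF pqi(2), folded Q_def]
  have \<phi>eq: "\<phi> x = P x \<otimes> a \<oplus> Q x \<otimes> b" if "x \<in> carrier (?F n)" for x
    using that
  proof (induction x rule: free_module_induct)
    case zero
    then show ?case
      using module_hom_zero[OF Fn.module_axioms M \<phi>] ab by (simp add: PQz Mops)
  next
    case (add x y)
    have "(P x \<oplus> P y) \<otimes> a \<oplus> (Q x \<oplus> Q y) \<otimes> b = (P x \<otimes> a \<oplus> Q x \<otimes> b) \<oplus> (P y \<otimes> a \<oplus> Q y \<otimes> b)"
      using PQc[OF add(1)] PQc[OF add(2)] ab by algebra
    then show ?case using add by (simp add: \<phi>add PQadd)
  next
    case (smult k x)
    have "(k \<otimes> P x) \<otimes> a \<oplus> (k \<otimes> Q x) \<otimes> b = k \<otimes> (P x \<otimes> a \<oplus> Q x \<otimes> b)"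
      using PQc[OF smult(2)] smult(1) ab by algebra
    then show ?case using smult by (simp add: \<phi>sm PQsm)
  next
    case (unit i)
    then show ?case by (simp add: PQu pq)
  qed
  define S where "S = insert (\<one> \<ominus> P \<alpha>, \<ominus> Q \<alpha>) (insert (\<ominus> P \<beta>, \<one> \<ominus> Q \<beta>)
    ((\<lambda>i. (P (\<psi> (unit_vec R m i)), Q (\<psi> (unit_vec R m i)))) ` {..<m}))"
  note c = ab PQc[OF \<alpha>\<beta>(1)] PQc[OF \<alpha>\<beta>(2)]
  have kerz: "P z \<otimes> a \<oplus> Q z \<otimes> b = \<zero>" if "z \<in> carrier (?F n)" "\<phi> z = \<zero>" for z
    using \<phi>eq that by simp
  have "finite S" by (simp add: S_def)
  moreover have "S \<subseteq> syzygies R a b"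
  proof -
    have "(\<one> \<ominus> P \<alpha>) \<otimes> a \<oplus> \<ominus> Q \<alpha> \<otimes> b = a \<ominus> (P \<alpha> \<otimes> a \<oplus> Q \<alpha> \<otimes> b)" using c by algebra
    also have "\<dots> = \<zero>" using \<phi>eq[OF \<alpha>\<beta>(1)] \<alpha>\<beta>(3) c by (simp add: r_neg minus_eq)
    finally have 1: "(\<one> \<ominus> P \<alpha>, \<ominus> Q \<alpha>) \<in> syzygies R a b" using c by (simp add: syzygies_def)
    have "\<ominus> P \<beta> \<otimes> a \<oplus> (\<one> \<ominus> Q \<beta>) \<otimes> b = b \<ominus> (P \<beta> \<otimes> a \<oplus> Q \<beta> \<otimes> b)" using c by algebra
    also have "\<dots> = \<zero>" using \<phi>eq[OF \<alpha>\<beta>(2)] \<alpha>\<beta>(4) c by (simp add: r_neg minus_eq)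
    finally have 2: "(\<ominus> P \<beta>, \<one> \<ominus> Q \<beta>) \<in> syzygies R a b" using c by (simp add: syzygies_def)
    have "(P (\<psi> (unit_vec R m i)), Q (\<psi> (unit_vec R m i))) \<in> syzygies R a b" for i
    proof -
      have "\<psi> (unit_vec R m i) \<in> {x \<in> carrier (?F n). \<phi> x = \<zero>}"
        using ker unit_vec_carrier unfolding Mops by blast
      then show ?thesis using kerz PQc by (auto simp: syzygies_def)
    qed
    then show ?thesis using 1 2 by (auto simp: S_def)
  qed
  moreover have "syzygies R a b \<subseteq> N" if N: "pair_submodule R N" "S \<subseteq> N" for N
  proof
    note Nc = pair_submoduleD[OF N(1)]
    have \<psi>N: "(P (\<psi> x), Q (\<psi> x)) \<in> N" if "x \<in> carrier (?F m)" for x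
      using that
    proof (induction x rule: free_module_induct)
      case zero
      then show ?case
        using module_hom_zero[OF Fm.module_axioms Fn.module_axioms \<psi>] Nc(2) by (simp add: PQz)
    next
      case (add x y)
      then show ?case
        using module_hom_closed[OF \<psi>] Nc(3) by (simp add: module_hom_add[OF \<psi>] PQadd)
    next
      case (smult k x)
      then show ?case
        using module_hom_closed[OF \<psi>] Nc(4) by (simp add: module_hom_smult[OF \<psi>] PQsm)
    next
      case (unit i)
      then show ?case using N(2) by (auto simp: S_def)
    qed
    fix z assume "z \<in> syzygies R a b"
    then obtain x y where z: "z = (x, y)" and xy: "x \<in> carrier R" "y \<in> carrier R" "x \<otimes> a \<oplus> y \<otimes> b = \<zero>"
      by (auto simp: syzygies_def)
    \<comment> \<open>Since \<open>\<phi>\<close> maps \<open>?w\<close> to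
      \<open>x \<otimes> a \<oplus> y \<otimes> b\<close>, it is a relation on the given generators.
      The pair \<open>(x, y)\<close> is \<open>(P ?w, Q ?w)\<close> plus \<open>x\<close> and
      \<open>y\<close> times the first two elements of \<open>S\<close>.\<close>
    let ?w = "x \<odot>\<^bsub>?F n\<^esub> \<alpha> \<oplus>\<^bsub>?F n\<^esub> y \<odot>\<^bsub>?F n\<^esub> \<beta>"
    have w: "?w \<in> carrier (?F n)" using xy \<alpha>\<beta> by auto
    have "\<phi> ?w = \<zero>" using xy \<alpha>\<beta> by (simp add: \<phi>add \<phi>sm)
    then obtain t where "t \<in> carrier (?F m)" "\<psi> t = ?w" using ker w Mops by (metis (mono_tags, lifting) imageE mem_Collect_eq)
    then have "(P ?w, Q ?w) \<in> N" using \<psi>N by metis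
    moreover have "P ?w = x \<otimes> P \<alpha> \<oplus> y \<otimes> P \<beta>" "Q ?w = x \<otimes> Q \<alpha> \<oplus> y \<otimes> Q \<beta>"
      using xy \<alpha>\<beta> by (simp_all add: PQadd PQsm)
    moreover have "(x \<otimes> (\<one> \<ominus> P \<alpha>), x \<otimes> \<ominus> Q \<alpha>) \<in> N" "(y \<otimes> \<ominus> P \<beta>, y \<otimes> (\<one> \<ominus> Q \<beta>)) \<in> N"
      using N(2) xy Nc(4) by (auto simp: S_def)
    ultimately have "((x \<otimes> (\<one> \<ominus> P \<alpha>) \<oplus> y \<otimes> \<ominus> P \<beta>) \<oplus> (x \<otimes> P \<alpha> \<oplus> y \<otimes> P \<beta>),
        (x \<otimes> \<ominus> Q \<alpha> \<oplus> y \<otimes> (\<one> \<ominus> Q \<beta>)) \<oplus> (x \<otimes> Q \<alpha> \<oplus> y \<otimes> Q \<beta>)) \<in> N"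
      using Nc(3) by auto
    moreover have "(x \<otimes> (\<one> \<ominus> P \<alpha>) \<oplus> y \<otimes> \<ominus> P \<beta>) \<oplus> (x \<otimes> P \<alpha> \<oplus> y \<otimes> P \<beta>) = x"
      using xy(1,2) c by algebra
    moreover have "(x \<otimes> \<ominus> Q \<alpha> \<oplus> y \<otimes> (\<one> \<ominus> Q \<beta>)) \<oplus> (x \<otimes> Q \<alpha> \<oplus> y \<otimes> Q \<beta>) = y"
      using xy(1,2) c by algebra
    ultimately show "z \<in> N" using z by simp
  qed
  ultimately show ?thesis unfolding syzygies_fg_def by blast
qed

section \<open>Relations on the zero pair and on unimodular pairs\<close>

text \<open>This case is treated apart because the hypothesis on two-generated ideals leaves out the
  zero ideal; here every pair is a relation and the standard basis generates.\<close>

lemma syzygies_fg_zero: "syzygies_fg R \<zero> \<zero>"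
proof -
  have "syzygies R \<zero> \<zero> \<subseteq> N" if N: "pair_submodule R N" "{(\<one>, \<zero>), (\<zero>, \<one>)} \<subseteq> N" for N
  proof (clarify)
    fix x y assume "(x, y) \<in> syzygies R \<zero> \<zero>"
    then have xy: "x \<in> carrier R" "y \<in> carrier R" by (auto simp: syzygies_def)
    then have "(x \<otimes> \<one> \<oplus> y \<otimes> \<zero>, x \<otimes> \<zero> \<oplus> y \<otimes> \<one>) \<in> N"
      using N(2) xy by (intro pair_submoduleD(3,4)[OF N(1)]) auto
    then show "(x, y) \<in> N" using xy by simp
  qed
  then show ?thesis
    unfolding syzygies_fg_def by (intro exI[of _ "{(\<one>, \<zero>), (\<zero>, \<one>)}"]) (auto simp: syzygies_def)
qed

lemma pair_submodule_syzygies: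
  assumes ab: "a \<in> carrier R" "b \<in> carrier R"
  shows "pair_submodule R (syzygies R a b)"
  unfolding pair_submodule_def
proof (intro conjI allI impI ballI)
  fix x y x' y' assume "(x, y) \<in> syzygies R a b" "(x', y') \<in> syzygies R a b"
  then have c: "x \<in> carrier R" "y \<in> carrier R" "x' \<in> carrier R" "y' \<in> carrier R"
    and e: "x \<otimes> a \<oplus> y \<otimes> b = \<zero>" "x' \<otimes> a \<oplus> y' \<otimes> b = \<zero>" by (auto simp: syzygies_def)
  have "(x \<oplus> x') \<otimes> a \<oplus> (y \<oplus> y') \<otimes> b = (x \<otimes> a \<oplus> y \<otimes> b) \<oplus> (x' \<otimes> a \<oplus> y' \<otimes> b)"
    using c ab by algebra
  then show "(x \<oplus> x', y \<oplus> y') \<in> syzygies R a b" using c e by (simp add: syzygies_def)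
next
  fix k x y assume k: "k \<in> carrier R" and "(x, y) \<in> syzygies R a b"
  then have c: "x \<in> carrier R" "y \<in> carrier R" and e: "x \<otimes> a \<oplus> y \<otimes> b = \<zero>"
    by (auto simp: syzygies_def)
  have "(k \<otimes> x) \<otimes> a \<oplus> (k \<otimes> y) \<otimes> b = k \<otimes> (x \<otimes> a \<oplus> y \<otimes> b)"
    using k c ab by algebra
  then show "(k \<otimes> x, k \<otimes> y) \<in> syzygies R a b" using k c e by (simp add: syzygies_def)
qed (use ab in \<open>auto simp: syzygies_def\<close>)

text \<open>Cramer's rule: the factor is the determinant of the matrix with rows
  \<open>(x, y)\<close> and \<open>(\<alpha>, \<beta>)\<close>. The relations on a unimodular pair
  thus need only the generator \<open>(v, \<ominus> u)\<close>.\<close>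

lemma unimodular_syzygy:
  assumes c: "u \<in> carrier R" "v \<in> carrier R" "\<alpha> \<in> carrier R" "\<beta> \<in> carrier R" "x \<in> carrier R" "y \<in> carrier R"
    and uv: "\<alpha> \<otimes> u \<oplus> \<beta> \<otimes> v = \<one>" and xy: "x \<otimes> u \<oplus> y \<otimes> v = \<zero>"
  shows "x = (\<beta> \<otimes> x \<ominus> \<alpha> \<otimes> y) \<otimes> v" "y = (\<beta> \<otimes> x \<ominus> \<alpha> \<otimes> y) \<otimes> \<ominus> u"
proof -
  have "(\<beta> \<otimes> x \<ominus> \<alpha> \<otimes> y) \<otimes> v = x \<otimes> (\<alpha> \<otimes> u \<oplus> \<beta> \<otimes> v) \<ominus> \<alpha> \<otimes> (x \<otimes> u \<oplus> y \<otimes> v)"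
    using c by algebra
  then show "x = (\<beta> \<otimes> x \<ominus> \<alpha> \<otimes> y) \<otimes> v" using c unfolding uv xy by (simp add: minus_eq)
  have "(\<beta> \<otimes> x \<ominus> \<alpha> \<otimes> y) \<otimes> \<ominus> u = y \<otimes> (\<alpha> \<otimes> u \<oplus> \<beta> \<otimes> v) \<ominus> \<beta> \<otimes> (x \<otimes> u \<oplus> y \<otimes> v)"
    using c by algebra
  then show "y = (\<beta> \<otimes> x \<ominus> \<alpha> \<otimes> y) \<otimes> \<ominus> u" using c unfolding uv xy by (simp add: minus_eq)
qed

text \<open>The conductor property becomes a statement on relations alone, in which \<open>a\<close>
  and \<open>b\<close> may be replaced by any pair with the same relations.\<close>

lemma finite_conductor_ring_iff:
  "finite_conductor_ring R \<longleftrightarrow> (\<forall>a\<in>carrier R. \<forall>b\<in>carrier R. syzygies_fg R a b)"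
proof
  assume R: "finite_conductor_ring R"
  show "\<forall>a\<in>carrier R. \<forall>b\<in>carrier R. syzygies_fg R a b"
  proof (intro ballI)
    fix a b assume ab: "a \<in> carrier R" "b \<in> carrier R"
    then have "two_generated R (Idl {a, b})" unfolding two_generated_def by blast
    then show "syzygies_fg R a b"
      using R fp_imp_syzygies_fg[OF ab] unfolding finite_conductor_ring_def by blast
  qed
next
  assume fg: "\<forall>a\<in>carrier R. \<forall>b\<in>carrier R. syzygies_fg R a b"
  have "finitely_presented R (mult_module R I)" if I: "two_generated R I" for I
  proof -
    obtain a b where ab: "a \<in> carrier R" "b \<in> carrier R" "I = Idl {a, b}"
      using I unfolding two_generated_def by blast
    then show ?thesis using fg syzygies_fg_imp_fp by blast
  qed
  then show "finite_conductor_ring R" unfolding finite_conductor_ring_def using is_cring by blast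
qed

end

section \<open>Conductor squares in which two-generated ideals become unimodular\<close>

text \<open>Here \<open>Idl U\<close> is the extension of \<open>U\<close> to \<open>T\<close>, the
  equation \<open>PIdl r = carrier T\<close> makes \<open>r\<close> a unit of \<open>T\<close>, and
  \<open>r <# I\<close> is the set of multiples of \<open>r\<close> by elements of
  \<open>I\<close>.\<close>

locale unimodular_square = regular_conductor_square +
  assumes principal: "principalideal C T"
    and two_gen: "\<And>I. two_generated (T\<lparr>carrier := R\<rparr>) I \<Longrightarrow> I \<noteq> {\<zero>} \<Longrightarrow>
      \<exists>r\<in>R. \<exists>s\<in>R. \<exists>U. ideal U (T\<lparr>carrier := R\<rparr>) \<and>
        Idl U = carrier T \<and> PIdl r = carrier T \<and> r <# I = s <# U \<and>
        (\<lambda>x. r \<otimes> x) \<in> module_iso (T\<lparr>carrier := R\<rparr>) (mult_module T I) (mult_module T (r <# I)) \<and>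
        (\<lambda>x. s \<otimes> x) \<in> module_iso (T\<lparr>carrier := R\<rparr>) (mult_module T U) (mult_module T (s <# U))"
begin

section \<open>The rings of the square and their common ideal\<close>

abbreviation "RR \<equiv> T\<lparr>carrier := R\<rparr>"
abbreviation "A \<equiv> RR Quot C"
abbreviation "h \<equiv> a_r_coset RR C"

lemma R_carrier: "R \<subseteq> carrier T"
  using subcringE(1)[OF subcring] .

lemmas R_in_T [simp, intro] = subsetD[OF R_carrier]
lemmas R_closed [simp, intro] = subcringE(2,3,5,6,7)[OF subcring]

lemma R_minus [simp, intro]: "x \<in> R \<Longrightarrow> y \<in> R \<Longrightarrow> x \<ominus> y \<in> R"
  by (simp add: minus_eq)

sublocale RR: cring RR
  using subcring_iff[OF R_carrier] subcring by simp

sublocale C: ideal C T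
  using conductor_common by (simp add: common_ideal_def)

sublocale CR: ideal C RR
  using conductor_common by (simp add: common_ideal_def)

lemma C_in_R [simp, intro]: "c \<in> C \<Longrightarrow> c \<in> R"
  using CR.a_subset by auto

sublocale A: cring A
  by (rule CR.quotient_is_cring[OF RR.is_cring])

section \<open>The domain \<open>T\<close> and unimodular pairs\<close>

text \<open>Let \<open>x \<otimes> y = \<zero>\<close> with \<open>x\<close> non-zero, and let
  \<open>c\<close> be a non-zero-divisor in \<open>C\<close>. The hypothesis for the ideal of
  \<open>R\<close> generated by \<open>c \<otimes> x\<close> yields \<open>U\<close>, all of whose
  elements annihilate \<open>y\<close>. Since \<open>U\<close> generates the unit ideal of
  \<open>T\<close>, also \<open>\<one>\<close> annihilates \<open>y\<close>.\<close>

sublocale domain T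
proof (rule domainI)
  \<comment> \<open>A non-zero ideal of \<open>T\<close> excludes the zero ring.\<close>
  obtain J where J: "ideal J T" "J \<noteq> {\<zero>}"
    using nonzero_common_ideal by (auto simp: common_ideal_def)
  show "\<one> \<noteq> \<zero>"
  proof
    assume "\<one> = \<zero>"
    then have "carrier T = {\<zero>}" using one_zeroD by blast
    then show False
      using J additive_subgroup.a_subset[OF ideal.axioms(1)[OF J(1)]]
        additive_subgroup.zero_closed[OF ideal.axioms(1)[OF J(1)]] by auto
  qed
next
  fix x y assume xy: "x \<otimes> y = \<zero>" "x \<in> carrier T" "y \<in> carrier T"
  obtain c where c: "c \<in> C" "\<And>t. t \<in> carrier T \<Longrightarrow> c \<otimes> t = \<zero> \<Longrightarrow> t = \<zero>"
    using regular by blast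
  have cT: "c \<in> carrier T" using c(1) by auto
  show "x = \<zero> \<or> y = \<zero>"
  proof (rule disjCI)
    assume y0: "y \<noteq> \<zero>"
    show "x = \<zero>"
    proof (rule ccontr)
      assume x0: "x \<noteq> \<zero>"
      have cx: "c \<otimes> x \<in> R" and cy: "c \<otimes> y \<in> R"
        using C.I_r_closed[OF c(1)] xy by auto
      \<comment> \<open>The factor \<open>c\<close> moves \<open>x\<close> from \<open>T\<close>
        into \<open>R\<close>, and a principal ideal counts as two-generated with second generator
        \<open>\<zero>\<close>.\<close>
      define I where "I = Idl\<^bsub>RR\<^esub> {c \<otimes> x, \<zero>}"
      have I: "I = {p \<otimes> (c \<otimes> x) \<oplus> q \<otimes> \<zero> | p q. p \<in> R \<and> q \<in> R}"
        unfolding I_def using RR.genideal_pair[of "c \<otimes> x" \<zero>] cx by simp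
      have "two_generated RR I"
        unfolding two_generated_def I_def using cx by (intro bexI[of _ "c \<otimes> x"] bexI[of _ \<zero>]) auto
      moreover have "c \<otimes> x \<in> I"
        unfolding I_def using RR.genideal_self[of "{c \<otimes> x, \<zero>}"] cx by auto
      then have "I \<noteq> {\<zero>}" using c(2)[OF xy(2)] x0 by auto
      ultimately obtain r s U where rsU: "r \<in> R" "s \<in> R" "ideal U RR" "Idl U = carrier T"
        "r <# I = s <# U"
        "(\<lambda>x. s \<otimes> x) \<in> module_iso RR (mult_module T U) (mult_module T (s <# U))"
        using two_gen by meson
      interpret U: ideal U RR by fact
      have UR: "w \<in> R" if "w \<in> U" for w using U.a_subset that by auto
      have inj: "inj_on (\<lambda>x. s \<otimes> x) U"
        using rsU(6) by (auto simp: module_iso_def mult_module_def bij_betw_def)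
      have ann: "w \<otimes> y = \<zero>" if w: "w \<in> U" for w
      proof -
        have "s \<otimes> w \<in> r <# I" unfolding rsU(5) using w by (auto simp: l_coset_def)
        then obtain i where i: "i \<in> I" "s \<otimes> w = r \<otimes> i" by (auto simp: l_coset_def)
        then obtain p q where pq: "p \<in> R" "q \<in> R" "s \<otimes> w = r \<otimes> (p \<otimes> (c \<otimes> x) \<oplus> q \<otimes> \<zero>)"
          using I by blast
        note m = R_in_T[OF pq(1)] R_in_T[OF pq(2)] R_in_T[OF rsU(1)] R_in_T[OF rsU(2)] R_in_T[OF UR[OF w]] cT xy(2,3)
        \<comment> \<open>Multiplication by \<open>s\<close> is given as injective only on
          \<open>U\<close>. The element \<open>w \<otimes> (c \<otimes> y)\<close> lies in
          \<open>U\<close> because \<open>c \<otimes> y\<close> is in \<open>R\<close>, which is not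
          known for \<open>w \<otimes> y\<close>.\<close>
        have "s \<otimes> (w \<otimes> (c \<otimes> y)) = c \<otimes> y \<otimes> (s \<otimes> w)" using m by algebra
        also have "\<dots> = r \<otimes> p \<otimes> c \<otimes> c \<otimes> (x \<otimes> y)" unfolding pq(3) using m by algebra
        also have "\<dots> = s \<otimes> \<zero>" unfolding xy(1) using m by simp
        finally have "w \<otimes> (c \<otimes> y) = \<zero>"
          using inj_onD[OF inj, of "w \<otimes> (c \<otimes> y)" \<zero>] U.I_r_closed[OF w] cy U.zero_closed by simp
        then have "c \<otimes> (w \<otimes> y) = \<zero>" using m by (simp add: m_lcomm)
        then show ?thesis using c(2) m by simp
      qed
      have "Idl U \<subseteq> {z \<in> carrier T. z \<otimes> y = \<zero>}"
        by (rule genideal_minimal[OF annihilator_ideal[OF xy(3)]]) (use ann UR in auto)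
      moreover have "\<one> \<in> Idl U" using rsU(4) by simp
      ultimately show False using xy(3) y0 by auto
    qed
  qed
qed (rule is_cring)

lemma ex_conductor_generator: "\<exists>c\<in>carrier T. c \<noteq> \<zero> \<and> C = PIdl c"
proof -
  obtain c where c: "c \<in> carrier T" "C = Idl {c}"
    using principalideal.generate[OF principal] by (elim bexE)
  obtain J where J: "J \<subseteq> C" "J \<noteq> {\<zero>}" "\<zero> \<in> J"
    using nonzero_common_ideal conductor_largest
    by (metis common_ideal_def additive_subgroup.zero_closed ideal.axioms(1))
  then have "C \<noteq> {\<zero>}" by blast
  then have "c \<noteq> \<zero>" using c(2) genideal_zero by auto
  then show ?thesis using c cgenideal_eq_genideal[OF c(1)] by (intro bexI[of _ c]) simp_all
qed

text \<open>The equation \<open>r <# I = s <# U\<close> gives \<open>u\<close> and \<open>v\<close>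
  in \<open>U\<close>, and \<open>s\<close> is non-zero because \<open>r\<close> is a unit of
  \<open>T\<close>. For \<open>w\<close> in \<open>U\<close>, \<open>s \<otimes> w\<close> is a
  combination of \<open>s \<otimes> u\<close> and \<open>s \<otimes> v\<close>; cancelling
  \<open>s\<close> in the domain \<open>T\<close> puts \<open>U\<close> inside the ideal of
  \<open>T\<close> generated by \<open>u\<close> and \<open>v\<close>.\<close>

lemma ex_unimodular:
  assumes xy: "x \<in> R" "y \<in> R" "x \<noteq> \<zero> \<or> y \<noteq> \<zero>"
  shows "\<exists>r\<in>R. \<exists>s\<in>R. \<exists>u\<in>R. \<exists>v\<in>R. \<exists>r'\<in>carrier T. \<exists>\<alpha>\<in>carrier T. \<exists>\<beta>\<in>carrier T.
    r' \<otimes> r = \<one> \<and> s \<noteq> \<zero> \<and> r \<otimes> x = s \<otimes> u \<and> r \<otimes> y = s \<otimes> v \<and> \<alpha> \<otimes> u \<oplus> \<beta> \<otimes> v = \<one>"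
proof -
  define I where "I = Idl\<^bsub>RR\<^esub> {x, y}"
  have I: "I = {p \<otimes> x \<oplus> q \<otimes> y | p q. p \<in> R \<and> q \<in> R}"
    unfolding I_def using RR.genideal_pair[of x y] xy by simp
  have xyI: "x \<in> I" "y \<in> I"
    unfolding I_def using RR.genideal_self[of "{x, y}"] xy by auto
  have "two_generated RR I"
    unfolding two_generated_def I_def using xy by (intro bexI[of _ x] bexI[of _ y]) auto
  moreover have "I \<noteq> {\<zero>}" using xyI xy(3) by auto
  ultimately obtain r s U where rsU: "r \<in> R" "s \<in> R" "ideal U RR" "Idl U = carrier T"
    "PIdl r = carrier T" "r <# I = s <# U"
    using two_gen by meson
  interpret U: ideal U RR by fact
  have UR: "w \<in> R" if "w \<in> U" for w using U.a_subset that by auto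
  have "r \<otimes> x \<in> s <# U" "r \<otimes> y \<in> s <# U"
    unfolding rsU(6)[symmetric] using xyI by (auto simp: l_coset_def)
  then obtain u v where uv: "u \<in> U" "v \<in> U" "r \<otimes> x = s \<otimes> u" "r \<otimes> y = s \<otimes> v"
    by (auto simp: l_coset_def)
  note uvR = UR[OF uv(1)] UR[OF uv(2)]
  have "\<one> \<in> PIdl r" using rsU(5) by simp
  then obtain r' where r': "r' \<in> carrier T" "r' \<otimes> r = \<one>" by (auto simp: cgenideal_def)
  have s0: "s \<noteq> \<zero>"
  proof
    assume "s = \<zero>"
    then have z: "r \<otimes> x = \<zero>" "r \<otimes> y = \<zero>" using uv uvR by auto
    have "r' \<otimes> r \<otimes> x = r' \<otimes> (r \<otimes> x)" "r' \<otimes> r \<otimes> y = r' \<otimes> (r \<otimes> y)"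
      using r'(1) rsU(1) xy by (auto simp: m_assoc)
    then show False using r' xy unfolding z by auto
  qed
  have "U \<subseteq> {p \<otimes> u \<oplus> q \<otimes> v | p q. p \<in> carrier T \<and> q \<in> carrier T}"
  proof
    fix w assume w: "w \<in> U"
    then have "s \<otimes> w \<in> r <# I" unfolding rsU(6) by (auto simp: l_coset_def)
    then obtain p q where pq: "p \<in> R" "q \<in> R" "s \<otimes> w = r \<otimes> (p \<otimes> x \<oplus> q \<otimes> y)"
      unfolding I by (auto simp: l_coset_def)
    note m = R_in_T[OF pq(1)] R_in_T[OF pq(2)] R_in_T[OF rsU(1)] R_in_T[OF rsU(2)] R_in_T[OF UR[OF w]]
      R_in_T[OF xy(1)] R_in_T[OF xy(2)] R_in_T[OF uvR(1)] R_in_T[OF uvR(2)]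
    have "r \<otimes> (p \<otimes> x \<oplus> q \<otimes> y) = p \<otimes> (r \<otimes> x) \<oplus> q \<otimes> (r \<otimes> y)" using m by algebra
    also have "\<dots> = s \<otimes> (p \<otimes> u \<oplus> q \<otimes> v)" unfolding uv(3,4) using m by algebra
    finally have "w = p \<otimes> u \<oplus> q \<otimes> v" using pq(3) m_lcancel[OF s0] m by simp
    then show "w \<in> {p \<otimes> u \<oplus> q \<otimes> v | p q. p \<in> carrier T \<and> q \<in> carrier T}" using m by blast
  qed
  then have "U \<subseteq> Idl {u, v}" using genideal_pair uvR by simp
  moreover have "ideal (Idl {u, v}) T" using uvR by (intro genideal_ideal) auto
  ultimately have "carrier T \<subseteq> Idl {u, v}" using genideal_minimal rsU(4) by metis
  then have "\<one> \<in> {p \<otimes> u \<oplus> q \<otimes> v | p q. p \<in> carrier T \<and> q \<in> carrier T}"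
    using genideal_pair uvR by auto
  then obtain \<alpha> \<beta> where "\<alpha> \<in> carrier T" "\<beta> \<in> carrier T" "\<alpha> \<otimes> u \<oplus> \<beta> \<otimes> v = \<one>" by force
  then show ?thesis using rsU(1,2) uvR r' s0 uv(3,4) by blast
qed

lemma syzygies_RR: "syzygies RR a b = {(x, y). x \<in> R \<and> y \<in> R \<and> x \<otimes> a \<oplus> y \<otimes> b = \<zero>}"
  by (simp add: syzygies_def)

text \<open>Every two-generated ideal of \<open>T\<close> is \<open>0\<close> or isomorphic to one with unimodular generators
  \<open>u, v\<close>, whose relations are the multiples of \<open>(v, \<ominus> u)\<close>.\<close>

lemma finite_conductor_T: "finite_conductor_ring T"
  unfolding finite_conductor_ring_iff
proof (intro ballI)
  fix x y assume xy: "x \<in> carrier T" "y \<in> carrier T"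
  show "syzygies_fg T x y"
  proof (cases "x = \<zero> \<and> y = \<zero>")
    case True
    then show ?thesis using syzygies_fg_zero by simp
  next
    case False
    \<comment> \<open>Multiplying by the non-zero generator \<open>c\<close> of \<open>C\<close>
      moves \<open>x\<close> and \<open>y\<close> into \<open>R\<close> and keeps their relations,
      as \<open>T\<close> is a domain.\<close>
    obtain c where c: "c \<in> carrier T" "c \<noteq> \<zero>" "C = PIdl c" using ex_conductor_generator by metis
    have cC: "c \<in> C" unfolding c(3) by (rule cgenideal_self[OF c(1)])
    have cxy: "c \<otimes> x \<in> R" "c \<otimes> y \<in> R" using C.I_r_closed[OF cC] xy by auto
    have "c \<otimes> x \<noteq> \<zero> \<or> c \<otimes> y \<noteq> \<zero>" using False c(1,2) xy integral_iff by auto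
    then obtain r s u v r' \<alpha> \<beta> where e: "r \<in> R" "s \<in> R" "u \<in> R" "v \<in> R"
      "r' \<in> carrier T" "\<alpha> \<in> carrier T" "\<beta> \<in> carrier T" "r' \<otimes> r = \<one>" "s \<noteq> \<zero>"
      "r \<otimes> (c \<otimes> x) = s \<otimes> u" "r \<otimes> (c \<otimes> y) = s \<otimes> v" "\<alpha> \<otimes> u \<oplus> \<beta> \<otimes> v = \<one>"
      using ex_unimodular[OF cxy] by metis
    note m = R_in_T[OF e(1)] R_in_T[OF e(2)] R_in_T[OF e(3)] R_in_T[OF e(4)] e(5-7) c(1) xy
    have r0: "r \<noteq> \<zero>" using e(8) m by auto
    have key: "r \<otimes> c \<otimes> (p \<otimes> x \<oplus> q \<otimes> y) = s \<otimes> (p \<otimes> u \<oplus> q \<otimes> v)"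
      if "p \<in> carrier T" "q \<in> carrier T" for p q
    proof -
      have "r \<otimes> c \<otimes> (p \<otimes> x \<oplus> q \<otimes> y) = p \<otimes> (r \<otimes> (c \<otimes> x)) \<oplus> q \<otimes> (r \<otimes> (c \<otimes> y))" using m that by algebra
      also have "\<dots> = s \<otimes> (p \<otimes> u \<oplus> q \<otimes> v)" unfolding e(10,11) using m that by algebra
      finally show ?thesis .
    qed
    have iff: "p \<otimes> x \<oplus> q \<otimes> y = \<zero> \<longleftrightarrow> p \<otimes> u \<oplus> q \<otimes> v = \<zero>" if pq: "p \<in> carrier T" "q \<in> carrier T" for p q
    proof -
      have "p \<otimes> x \<oplus> q \<otimes> y = \<zero> \<longleftrightarrow> r \<otimes> c \<otimes> (p \<otimes> x \<oplus> q \<otimes> y) = \<zero>"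
        using m pq r0 c(2) by (simp add: integral_iff)
      also have "\<dots> \<longleftrightarrow> p \<otimes> u \<oplus> q \<otimes> v = \<zero>"
        unfolding key[OF pq] using m pq e(9) by (simp add: integral_iff)
      finally show ?thesis .
    qed
    have "v \<otimes> u \<oplus> \<ominus> u \<otimes> v = \<zero>" using m by algebra
    then have "{(v, \<ominus> u)} \<subseteq> syzygies T x y" using m iff by (simp add: syzygies_def)
    moreover have "syzygies T x y \<subseteq> N" if N: "pair_submodule T N" "{(v, \<ominus> u)} \<subseteq> N" for N
    proof (clarify)
      fix p q assume "(p, q) \<in> syzygies T x y"
      then have pq: "p \<in> carrier T" "q \<in> carrier T" "p \<otimes> u \<oplus> q \<otimes> v = \<zero>"
        using iff by (auto simp: syzygies_def)
      have "((\<beta> \<otimes> p \<ominus> \<alpha> \<otimes> q) \<otimes> v, (\<beta> \<otimes> p \<ominus> \<alpha> \<otimes> q) \<otimes> \<ominus> u) \<in> N"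
        using N(2) m pq by (intro pair_submoduleD(4)[OF N(1)]) auto
      then show "(p, q) \<in> N"
        using unimodular_syzygy[OF m(3,4,6,7) pq(1,2) e(12) pq(3)] by simp
    qed
    ultimately show ?thesis unfolding syzygies_fg_def by (intro exI[of _ "{(v, \<ominus> u)}"]) simp
  qed
qed

section \<open>Relations over \<open>A\<close> through representatives in \<open>R\<close>\<close>

lemma h_closed: "x \<in> R \<Longrightarrow> h x \<in> carrier A"
  and h_add: "x \<in> R \<Longrightarrow> y \<in> R \<Longrightarrow> h (x \<oplus> y) = h x \<oplus>\<^bsub>A\<^esub> h y"
  and h_mult: "x \<in> R \<Longrightarrow> y \<in> R \<Longrightarrow> h (x \<otimes> y) = h x \<otimes>\<^bsub>A\<^esub> h y"
  and h_one: "h \<one> = \<one>\<^bsub>A\<^esub>"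
  using ring_hom_closed[OF CR.rcos_ring_hom] ring_hom_add[OF CR.rcos_ring_hom]
    ring_hom_mult[OF CR.rcos_ring_hom] ring_hom_one[OF CR.rcos_ring_hom] by simp_all

lemma carrier_A: "carrier A = h ` R"
  by (auto simp: FactRing_def A_RCOSETS_def')

lemma h_eq_iff:
  assumes "x \<in> R" "y \<in> R"
  shows "h x = h y \<longleftrightarrow> x \<ominus> y \<in> C"
proof
  assume "h x = h y"
  then have "x \<in> h y" using CR.a_rcos_self[of x] assms by simp
  then obtain c where c: "c \<in> C" "x = c \<oplus> y" by (auto simp: a_r_coset_def')
  have "c \<oplus> y \<ominus> y = c" using R_in_T[OF C_in_R[OF c(1)]] R_in_T[OF assms(2)] by algebra
  then show "x \<ominus> y \<in> C" using c by simp
next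
  assume c: "x \<ominus> y \<in> C"
  have "(x \<ominus> y) \<oplus> y = x" using R_in_T[OF assms(1)] R_in_T[OF assms(2)] by algebra
  then have "x \<in> h y" using c by (force simp: a_r_coset_def')
  then show "h x = h y" using CR.a_repr_independence'[of x y] assms by simp
qed

lemma h_zero: "h \<zero> = \<zero>\<^bsub>A\<^esub>"
  using ring_hom_zero[OF CR.rcos_ring_hom RR.ring_axioms A.ring_axioms] by simp

lemma h_zero_iff: "x \<in> R \<Longrightarrow> h x = \<zero>\<^bsub>A\<^esub> \<longleftrightarrow> x \<in> C"
  using h_eq_iff[of x \<zero>] by (simp add: h_zero minus_eq)

text \<open>The preimage in \<open>R \<times> R\<close> of the relations on \<open>h a\<close> and
  \<open>h b\<close>; it replaces cosets by representatives.\<close>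

definition syzygies_mod :: "'a \<Rightarrow> 'a \<Rightarrow> ('a \<times> 'a) set"
  where "syzygies_mod a b = {(x, y). x \<in> R \<and> y \<in> R \<and> x \<otimes> a \<oplus> y \<otimes> b \<in> C}"

lemma syzygies_A:
  assumes "a \<in> R" "b \<in> R"
  shows "syzygies A (h a) (h b) = map_prod h h ` syzygies_mod a b"
proof -
  have "h x \<otimes>\<^bsub>A\<^esub> h a \<oplus>\<^bsub>A\<^esub> h y \<otimes>\<^bsub>A\<^esub> h b = \<zero>\<^bsub>A\<^esub> \<longleftrightarrow> x \<otimes> a \<oplus> y \<otimes> b \<in> C"
    if "x \<in> R" "y \<in> R" for x y
    using that assms h_zero_iff[of "x \<otimes> a \<oplus> y \<otimes> b"] by (simp add: h_add h_mult)
  then show ?thesis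
    unfolding syzygies_def syzygies_mod_def carrier_A by (auto simp: image_iff)
qed

text \<open>Submodules of pairs over \<open>A\<close> correspond, by images and preimages under
  \<open>h\<close>, to the submodules over \<open>R\<close> that contain
  \<open>C \<times> C\<close>. Finite generation over \<open>A\<close> thus becomes finite
  generation modulo \<open>C \<times> C\<close>.\<close>

lemma syzygies_fg_A_iff:
  assumes ab: "a \<in> R" "b \<in> R"
  shows "syzygies_fg A (h a) (h b) \<longleftrightarrow> (\<exists>S. finite S \<and> S \<subseteq> syzygies_mod a b \<and>
    (\<forall>N. pair_submodule RR N \<longrightarrow> C \<times> C \<subseteq> N \<longrightarrow> S \<subseteq> N \<longrightarrow> syzygies_mod a b \<subseteq> N))"
proof
  let ?hh = "map_prod h h"
  assume "syzygies_fg A (h a) (h b)"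
  then obtain S' where S': "finite S'" "S' \<subseteq> ?hh ` syzygies_mod a b"
    "\<And>N. pair_submodule A N \<Longrightarrow> S' \<subseteq> N \<Longrightarrow> ?hh ` syzygies_mod a b \<subseteq> N"
    unfolding syzygies_fg_def syzygies_A[OF ab] by blast
  then obtain S where S: "S \<subseteq> syzygies_mod a b" "finite S" "S' = ?hh ` S"
    using finite_subset_image by metis
  have "syzygies_mod a b \<subseteq> N" if N: "pair_submodule RR N" "C \<times> C \<subseteq> N" "S \<subseteq> N" for N
  proof (clarify)
    note Nc = pair_submoduleD[OF N(1), simplified]
    have NR: "x \<in> R" "y \<in> R" if "(x, y) \<in> N" for x y using Nc(1) that by auto
    have "pair_submodule A (?hh ` N)"
      unfolding pair_submodule_def
    proof (intro conjI allI impI ballI)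
      show "?hh ` N \<subseteq> carrier A \<times> carrier A" using NR h_closed by auto
      show "(\<zero>\<^bsub>A\<^esub>, \<zero>\<^bsub>A\<^esub>) \<in> ?hh ` N"
        by (rule image_eqI[OF _ Nc(2)]) (simp add: h_zero)
    next
      fix x y x' y' assume "(x, y) \<in> ?hh ` N" "(x', y') \<in> ?hh ` N"
      then obtain p q p' q' where pq: "(p, q) \<in> N" "(p', q') \<in> N"
        "x = h p" "y = h q" "x' = h p'" "y' = h q'" by auto
      then show "(x \<oplus>\<^bsub>A\<^esub> x', y \<oplus>\<^bsub>A\<^esub> y') \<in> ?hh ` N"
        using NR by (intro image_eqI[OF _ Nc(3)[OF pq(1,2)]]) (simp add: h_add)
    next
      fix k x y assume "k \<in> carrier A" "(x, y) \<in> ?hh ` N"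
      then obtain l p q where pq: "l \<in> R" "(p, q) \<in> N" "k = h l" "x = h p" "y = h q"
        by (auto simp: carrier_A)
      then show "(k \<otimes>\<^bsub>A\<^esub> x, k \<otimes>\<^bsub>A\<^esub> y) \<in> ?hh ` N"
        using NR by (intro image_eqI[OF _ Nc(4)[OF pq(1,2)]]) (simp add: h_mult)
    qed
    then have sub: "?hh ` syzygies_mod a b \<subseteq> ?hh ` N" using S'(3) S(3) N(3) by blast
    fix x y assume xy: "(x, y) \<in> syzygies_mod a b"
    then have xyR: "x \<in> R" "y \<in> R" by (auto simp: syzygies_mod_def)
    have "(h x, h y) \<in> ?hh ` N" using sub xy by force
    then obtain p q where pq: "(p, q) \<in> N" "h x = h p" "h y = h q" by auto
    then have "(x \<ominus> p, y \<ominus> q) \<in> N" using N(2) NR h_eq_iff xyR by auto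
    then have "((x \<ominus> p) \<oplus> p, (y \<ominus> q) \<oplus> q) \<in> N" using Nc(3) pq(1) by blast
    moreover have "(x \<ominus> p) \<oplus> p = x" "(y \<ominus> q) \<oplus> q = y"
      using R_in_T[OF xyR(1)] R_in_T[OF xyR(2)] R_in_T[OF NR(1)[OF pq(1)]] R_in_T[OF NR(2)[OF pq(1)]]
      by algebra+
    ultimately show "(x, y) \<in> N" by simp
  qed
  then show "\<exists>S. finite S \<and> S \<subseteq> syzygies_mod a b \<and>
    (\<forall>N. pair_submodule RR N \<longrightarrow> C \<times> C \<subseteq> N \<longrightarrow> S \<subseteq> N \<longrightarrow> syzygies_mod a b \<subseteq> N)"
    using S by blast
next
  let ?hh = "map_prod h h"
  assume "\<exists>S. finite S \<and> S \<subseteq> syzygies_mod a b \<and>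
    (\<forall>N. pair_submodule RR N \<longrightarrow> C \<times> C \<subseteq> N \<longrightarrow> S \<subseteq> N \<longrightarrow> syzygies_mod a b \<subseteq> N)"
  then obtain S where S: "finite S" "S \<subseteq> syzygies_mod a b"
    "\<And>N. pair_submodule RR N \<Longrightarrow> C \<times> C \<subseteq> N \<Longrightarrow> S \<subseteq> N \<Longrightarrow> syzygies_mod a b \<subseteq> N" by blast
  have "?hh ` syzygies_mod a b \<subseteq> N" if N: "pair_submodule A N" "?hh ` S \<subseteq> N" for N
  proof -
    note Nc = pair_submoduleD[OF N(1)]
    let ?N = "{(x, y). x \<in> R \<and> y \<in> R \<and> (h x, h y) \<in> N}"
    have "pair_submodule RR ?N"
      using Nc by (auto simp: pair_submodule_def h_add h_mult h_zero h_closed)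
    moreover have "C \<times> C \<subseteq> ?N" using Nc(2) h_zero_iff[THEN iffD2] by auto
    moreover have "S \<subseteq> ?N" using N(2) S(2) by (force simp: syzygies_mod_def)
    ultimately have "syzygies_mod a b \<subseteq> ?N" using S(3) by blast
    then show ?thesis by auto
  qed
  then show "syzygies_fg A (h a) (h b)"
    unfolding syzygies_fg_def syzygies_A[OF ab] using S(1,2) by (intro exI[of _ "?hh ` S"]) auto
qed

section \<open>Annihilators modulo the conductor\<close>

text \<open>Modulo \<open>C\<close> the element \<open>e\<close> is an idempotent that generates the
  annihilator of \<open>s\<close>: taking \<open>z = e\<close> gives idempotency. It comes from a
  unimodular pair \<open>u\<close>, \<open>v\<close> for \<open>s\<close> and the generator
  \<open>c\<close> of \<open>C\<close>: \<open>v\<close> kills \<open>s\<close> in \<open>A\<close>,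
  and every \<open>z\<close> in \<open>R\<close> that kills \<open>s\<close> modulo \<open>C\<close>
  is a multiple of \<open>v\<close> in \<open>T\<close>. Comaximality of the annihilators of
  \<open>s\<close> and \<open>v\<close> in \<open>A\<close> then produces \<open>e\<close>.\<close>

lemma annihilator_idempotent:
  assumes ld: "locally_domain A" and s: "s \<in> R"
  shows "\<exists>e\<in>R. e \<otimes> s \<in> C \<and> (\<forall>z\<in>R. z \<otimes> s \<in> C \<longrightarrow> (\<one> \<ominus> e) \<otimes> z \<in> C)"
proof -
  obtain c where c: "c \<in> carrier T" "c \<noteq> \<zero>" "C = PIdl c" using ex_conductor_generator by metis
  have cC: "c \<in> C" unfolding c(3) by (rule cgenideal_self[OF c(1)])
  obtain r d u v r' \<alpha> \<beta> where e: "r \<in> R" "d \<in> R" "u \<in> R" "v \<in> R"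
    "r' \<in> carrier T" "\<alpha> \<in> carrier T" "\<beta> \<in> carrier T" "r' \<otimes> r = \<one>" "d \<noteq> \<zero>"
    "r \<otimes> s = d \<otimes> u" "r \<otimes> c = d \<otimes> v" "\<alpha> \<otimes> u \<oplus> \<beta> \<otimes> v = \<one>"
    using ex_unimodular[OF s C_in_R[OF cC]] c(2) by metis
  note m = R_in_T[OF e(1)] R_in_T[OF e(2)] R_in_T[OF e(3)] R_in_T[OF e(4)] e(5-7) c(1) R_in_T[OF s]
  have r0: "r \<noteq> \<zero>" using e(8) m by auto
  \<comment> \<open>From \<open>z \<otimes> s = t \<otimes> c\<close>, cancelling \<open>d\<close>
    gives \<open>z \<otimes> u = t \<otimes> v\<close>; since \<open>u\<close> and \<open>v\<close>
    generate the unit ideal of \<open>T\<close>, \<open>v\<close> divides \<open>z\<close>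
    there.\<close>
  have div: "\<exists>t\<in>carrier T. z = v \<otimes> t" if z: "z \<in> R" "z \<otimes> s \<in> C" for z
  proof -
    obtain t where t: "t \<in> carrier T" "z \<otimes> s = t \<otimes> c" using z(2) unfolding c(3) cgenideal_def by blast
    note m = m R_in_T[OF z(1)] t(1)
    have "d \<otimes> (z \<otimes> u) = z \<otimes> (d \<otimes> u)" using m by algebra
    also have "\<dots> = r \<otimes> (z \<otimes> s)" unfolding e(10)[symmetric] using m by algebra
    also have "\<dots> = t \<otimes> (r \<otimes> c)" unfolding t(2) using m by algebra
    also have "\<dots> = d \<otimes> (t \<otimes> v)" unfolding e(11) using m by algebra
    finally have zu: "z \<otimes> u = t \<otimes> v" using m_lcancel[OF e(9)] m by simp
    have "z = z \<otimes> (\<alpha> \<otimes> u \<oplus> \<beta> \<otimes> v)" unfolding e(12) using m by simp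
    also have "\<dots> = \<alpha> \<otimes> (z \<otimes> u) \<oplus> z \<otimes> \<beta> \<otimes> v" using m by algebra
    also have "\<dots> = v \<otimes> (\<alpha> \<otimes> t \<oplus> z \<otimes> \<beta>)" unfolding zu using m by algebra
    finally show ?thesis using m by blast
  qed
  \<comment> \<open>Cross-multiplying the two factorizations through \<open>d\<close> and cancelling
    \<open>r\<close> gives \<open>s \<otimes> v = c \<otimes> u\<close>, an element of
    \<open>C\<close>.\<close>
  have "r \<otimes> (s \<otimes> v) = (r \<otimes> s) \<otimes> v" using m by algebra
  also have "\<dots> = u \<otimes> (d \<otimes> v)" unfolding e(10) using m by algebra
  also have "\<dots> = r \<otimes> (c \<otimes> u)" unfolding e(11)[symmetric] using m by algebra
  finally have "s \<otimes> v = c \<otimes> u" using m_lcancel[OF r0] m by simp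
  then have "s \<otimes> v \<in> C" using C.I_r_closed[OF cC] m by simp
  then have "h s \<otimes>\<^bsub>A\<^esub> h v = \<zero>\<^bsub>A\<^esub>" using h_zero_iff[of "s \<otimes> v"] s e(4) by (simp add: h_mult)
  then obtain x' y' where xy': "x' \<in> carrier A" "y' \<in> carrier A" "x' \<oplus>\<^bsub>A\<^esub> y' = \<one>\<^bsub>A\<^esub>"
    "x' \<otimes>\<^bsub>A\<^esub> h s = \<zero>\<^bsub>A\<^esub>" "y' \<otimes>\<^bsub>A\<^esub> h v = \<zero>\<^bsub>A\<^esub>"
    using A.locally_domain_comaximal[OF ld h_closed[OF s] h_closed[OF e(4)]] by metis
  then obtain x y where xy: "x \<in> R" "y \<in> R" "x' = h x" "y' = h y" by (auto simp: carrier_A)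
  have xs: "x \<otimes> s \<in> C" and yv: "y \<otimes> v \<in> C"
    using xy' xy s e(4) h_zero_iff[of "x \<otimes> s"] h_zero_iff[of "y \<otimes> v"] by (simp_all add: h_mult)
  have "h (x \<oplus> y) = h \<one>" using xy' xy by (simp add: h_add h_one)
  then have 1: "x \<oplus> y \<ominus> \<one> \<in> C" using h_eq_iff[of "x \<oplus> y" \<one>] xy by simp
  have "(\<one> \<ominus> x) \<otimes> z \<in> C" if z: "z \<in> R" "z \<otimes> s \<in> C" for z
  proof -
    obtain t where t: "t \<in> carrier T" "z = v \<otimes> t" using div[OF z] by blast
    note m = m R_in_T[OF z(1)] t(1) R_in_T[OF xy(1)] R_in_T[OF xy(2)]
    \<comment> \<open>The factor \<open>t\<close> lies only in \<open>T\<close>, but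
      \<open>C\<close> is an ideal of \<open>T\<close>, so
      \<open>(y \<otimes> v) \<otimes> t\<close> stays in \<open>C\<close>.\<close>
    have "y \<otimes> z = (y \<otimes> v) \<otimes> t" unfolding t(2) using m by algebra
    then have "y \<otimes> z \<in> C" using C.I_r_closed[OF yv t(1)] by simp
    moreover have "z \<otimes> (x \<oplus> y \<ominus> \<one>) \<in> C" using C.I_l_closed[OF 1] m by simp
    ultimately have "y \<otimes> z \<ominus> z \<otimes> (x \<oplus> y \<ominus> \<one>) \<in> C"
      by (simp add: minus_eq)
    moreover have "y \<otimes> z \<ominus> z \<otimes> (x \<oplus> y \<ominus> \<one>) = (\<one> \<ominus> x) \<otimes> z" using m by algebra
    ultimately show ?thesis by simp
  qed
  then show ?thesis using xs xy(1) by blast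
qed

section \<open>The conductor property passes from \<open>A\<close> to \<open>R\<close>\<close>

text \<open>The criterion for \<open>A\<close> tests only submodules that contain
  \<open>C \<times> C\<close>; adding \<open>C \<times> C\<close> to a submodule makes the criterion
  applicable.\<close>

lemma pair_submodule_add_C:
  assumes N: "pair_submodule RR N"
  shows "pair_submodule RR {(x \<oplus> c, y \<oplus> d) | x y c d. (x, y) \<in> N \<and> c \<in> C \<and> d \<in> C}" (is "pair_submodule RR ?N")
proof -
  note Nc = pair_submoduleD[OF N, simplified]
  have NT: "x \<in> carrier T" "y \<in> carrier T" if "(x, y) \<in> N" for x y using Nc(1) that by auto
  have NR: "x \<in> R" "y \<in> R" if "(x, y) \<in> N" for x y using Nc(1) that by auto
  have CT: "c \<in> carrier T" if "c \<in> C" for c using that by auto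
  have I: "(x', y') \<in> ?N" if "(x, y) \<in> N" "c \<in> C" "d \<in> C" "x' = x \<oplus> c" "y' = y \<oplus> d" for x y c d x' y'
    using that by blast
  show ?thesis
    unfolding pair_submodule_def
  proof (intro conjI allI impI ballI)
    show "?N \<subseteq> carrier RR \<times> carrier RR" using NR by auto
    show "(\<zero>\<^bsub>RR\<^esub>, \<zero>\<^bsub>RR\<^esub>) \<in> ?N"
      by (rule I[OF Nc(2) C.zero_closed C.zero_closed]) simp_all
  next
    fix x y x' y' assume "(x, y) \<in> ?N" "(x', y') \<in> ?N"
    then obtain p q c d p' q' c' d' where *: "(p, q) \<in> N" "c \<in> C" "d \<in> C" "x = p \<oplus> c" "y = q \<oplus> d"
      "(p', q') \<in> N" "c' \<in> C" "d' \<in> C" "x' = p' \<oplus> c'" "y' = q' \<oplus> d'" by blast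
    have "x \<oplus> x' = (p \<oplus> p') \<oplus> (c \<oplus> c')" "y \<oplus> y' = (q \<oplus> q') \<oplus> (d \<oplus> d')"
      unfolding *(4,5,9,10) using NT[OF *(1)] NT[OF *(6)] CT[OF *(2)] CT[OF *(3)] CT[OF *(7)] CT[OF *(8)]
      by algebra+
    then show "(x \<oplus>\<^bsub>RR\<^esub> x', y \<oplus>\<^bsub>RR\<^esub> y') \<in> ?N"
      using I[OF Nc(3)[OF *(1,6)] C.a_closed[OF *(2,7)] C.a_closed[OF *(3,8)]] by simp
  next
    fix k x y assume k: "k \<in> carrier RR" and "(x, y) \<in> ?N"
    then obtain p q c d where *: "(p, q) \<in> N" "c \<in> C" "d \<in> C" "x = p \<oplus> c" "y = q \<oplus> d" by blast
    have kR: "k \<in> R" "k \<in> carrier T" using k by auto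
    have "k \<otimes> x = k \<otimes> p \<oplus> k \<otimes> c" "k \<otimes> y = k \<otimes> q \<oplus> k \<otimes> d"
      unfolding *(4,5) using NT[OF *(1)] CT[OF *(2)] CT[OF *(3)] kR by (simp_all add: r_distr)
    then show "(k \<otimes>\<^bsub>RR\<^esub> x, k \<otimes>\<^bsub>RR\<^esub> y) \<in> ?N"
      using I[OF Nc(4)[OF kR(1) *(1)] C.I_l_closed[OF *(2) kR(2)] C.I_l_closed[OF *(3) kR(2)]] by simp
  qed
qed

text \<open>For unimodular \<open>u, v\<close>, relations modulo \<open>C\<close> lift to relations over \<open>R\<close>, because
  \<open>c = c \<otimes> \<alpha> \<otimes> u \<oplus> c \<otimes> \<beta> \<otimes> v\<close> with \<open>c \<otimes> \<alpha>, c \<otimes> \<beta> \<in> C\<close>; the relations in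
  \<open>C \<times> C\<close> are the multiples of \<open>(v, \<ominus> u)\<close> by elements of \<open>C\<close>.\<close>

lemma lift_syzygy:
  assumes uv: "u \<in> R" "v \<in> R" "\<alpha> \<in> carrier T" "\<beta> \<in> carrier T" "\<alpha> \<otimes> u \<oplus> \<beta> \<otimes> v = \<one>"
    and pq: "p \<in> R" "q \<in> R" and c: "p \<otimes> u \<oplus> q \<otimes> v \<in> C"
  shows "\<exists>c\<in>C. \<exists>d\<in>C. (p \<ominus> c, q \<ominus> d) \<in> syzygies RR u v"
proof -
  let ?c = "p \<otimes> u \<oplus> q \<otimes> v"
  have C: "?c \<otimes> \<alpha> \<in> C" "?c \<otimes> \<beta> \<in> C" using C.I_r_closed[OF c] uv by auto
  note m = R_in_T[OF uv(1)] R_in_T[OF uv(2)] uv(3,4) R_in_T[OF pq(1)] R_in_T[OF pq(2)]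
  have "(p \<ominus> ?c \<otimes> \<alpha>) \<otimes> u \<oplus> (q \<ominus> ?c \<otimes> \<beta>) \<otimes> v = ?c \<ominus> ?c \<otimes> (\<alpha> \<otimes> u \<oplus> \<beta> \<otimes> v)"
    using m by algebra
  also have "\<dots> = \<zero>" unfolding uv(5) using m by (simp add: minus_eq r_neg)
  finally have "(p \<ominus> ?c \<otimes> \<alpha>, q \<ominus> ?c \<otimes> \<beta>) \<in> syzygies RR u v"
    unfolding syzygies_RR using C pq by simp
  then show ?thesis using C by blast
qed

text \<open>Generators of the relations over \<open>A\<close> lift to relations over
  \<open>R\<close>, and with \<open>(v, \<ominus> u)\<close> added they generate: a relation over
  \<open>R\<close> differs from a combination of the lifts by a pair in \<open>C \<times> C\<close>,
  which is again a relation and hence a multiple of \<open>(v, \<ominus> u)\<close> by an element of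
  \<open>C\<close>.\<close>

lemma syzygies_fg_RR_unimodular:
  assumes uv: "u \<in> R" "v \<in> R" "\<alpha> \<in> carrier T" "\<beta> \<in> carrier T" "\<alpha> \<otimes> u \<oplus> \<beta> \<otimes> v = \<one>"
    and fg: "syzygies_fg A (h u) (h v)"
  shows "syzygies_fg RR u v"
proof -
  obtain S where S: "finite S" "S \<subseteq> syzygies_mod u v"
    "\<And>N. pair_submodule RR N \<Longrightarrow> C \<times> C \<subseteq> N \<Longrightarrow> S \<subseteq> N \<Longrightarrow> syzygies_mod u v \<subseteq> N"
    using fg unfolding syzygies_fg_A_iff[OF uv(1,2)] by blast
  have "\<forall>z\<in>S. \<exists>z'. z' \<in> syzygies RR u v \<and> fst z \<ominus> fst z' \<in> C \<and> snd z \<ominus> snd z' \<in> C"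
  proof
    fix z assume "z \<in> S"
    then obtain p q where pq: "z = (p, q)" "p \<in> R" "q \<in> R" "p \<otimes> u \<oplus> q \<otimes> v \<in> C"
      using S(2) by (auto simp: syzygies_mod_def)
    then obtain c d where cd: "c \<in> C" "d \<in> C" "(p \<ominus> c, q \<ominus> d) \<in> syzygies RR u v"
      using lift_syzygy[OF uv] by blast
    have "p \<ominus> (p \<ominus> c) = c" "q \<ominus> (q \<ominus> d) = d"
      using R_in_T[OF pq(2)] R_in_T[OF pq(3)] C.Icarr[OF cd(1)] C.Icarr[OF cd(2)] by algebra+
    then show "\<exists>z'. z' \<in> syzygies RR u v \<and> fst z \<ominus> fst z' \<in> C \<and> snd z \<ominus> snd z' \<in> C"
      using cd pq(1) by (intro exI[of _ "(p \<ominus> c, q \<ominus> d)"]) simp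
  qed
  then obtain f where f: "\<And>z. z \<in> S \<Longrightarrow> f z \<in> syzygies RR u v"
    "\<And>z. z \<in> S \<Longrightarrow> fst z \<ominus> fst (f z) \<in> C" "\<And>z. z \<in> S \<Longrightarrow> snd z \<ominus> snd (f z) \<in> C" by metis
  note m = R_in_T[OF uv(1)] R_in_T[OF uv(2)] uv(3,4)
  have "v \<otimes> u \<oplus> \<ominus> u \<otimes> v = \<zero>" using m by algebra
  then have vu: "(v, \<ominus> u) \<in> syzygies RR u v" using uv by (simp add: syzygies_RR)
  have "syzygies RR u v \<subseteq> N" if N: "pair_submodule RR N" "insert (v, \<ominus> u) (f ` S) \<subseteq> N" for N
  proof (clarify)
    note Nc = pair_submoduleD[OF N(1), simplified]
    \<comment> \<open>Intersecting with the relations ensures that what remains in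
      \<open>C \<times> C\<close> after subtracting an element of \<open>?K\<close> from a relation
      is itself a relation.\<close>
    let ?K = "N \<inter> syzygies RR u v"
    let ?N = "{(x \<oplus> c, y \<oplus> d) | x y c d. (x, y) \<in> ?K \<and> c \<in> C \<and> d \<in> C}"
    have K: "pair_submodule RR ?K"
      using N(1) RR.pair_submodule_syzygies[of u v] uv unfolding pair_submodule_def by auto
    have I: "(x', y') \<in> ?N" if "(x, y) \<in> ?K" "c \<in> C" "d \<in> C" "x' = x \<oplus> c" "y' = y \<oplus> d" for x y c d x' y'
      using that by blast
    have 1: "C \<times> C \<subseteq> ?N"
    proof (clarify)
      fix c d assume "c \<in> C" "d \<in> C"
      then show "\<exists>x y c' d'. (c, d) = (x \<oplus> c', y \<oplus> d') \<and> (x, y) \<in> ?K \<and> c' \<in> C \<and> d' \<in> C"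
        using pair_submoduleD(2)[OF K] by (intro exI[of _ \<zero>] exI[of _ c] exI[of _ d]) auto
    qed
    have 2: "S \<subseteq> ?N"
    proof
      fix z assume z: "z \<in> S"
      obtain p q where pq: "z = (p, q)" "p \<in> R" "q \<in> R"
        using S(2) z by (auto simp: syzygies_mod_def)
      obtain p' q' where pq': "f z = (p', q')" by (cases "f z")
      have sz: "(p', q') \<in> syzygies RR u v" using f(1)[OF z] pq' by simp
      then have R': "p' \<in> R" "q' \<in> R" by (auto simp: syzygies_RR)
      have "p = p' \<oplus> (p \<ominus> p')" "q = q' \<oplus> (q \<ominus> q')"
        using R_in_T[OF pq(2)] R_in_T[OF pq(3)] R_in_T[OF R'(1)] R_in_T[OF R'(2)] by algebra+
      moreover have "(p', q') \<in> ?K" using N(2) z sz pq' by force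
      ultimately show "z \<in> ?N"
        unfolding pq(1) using f(2,3)[OF z] pq(1) pq' by (intro I[of p' q' "p \<ominus> p'" "q \<ominus> q'"]) auto
    qed
    fix x y assume xy: "(x, y) \<in> syzygies RR u v"
    then have "(x, y) \<in> syzygies_mod u v" using C.zero_closed by (auto simp: syzygies_RR syzygies_mod_def)
    then have "(x, y) \<in> ?N" using S(3)[OF pair_submodule_add_C[OF K] 1 2] by blast
    then obtain p q c d where *: "x = p \<oplus> c" "y = q \<oplus> d" "(p, q) \<in> N" "(p, q) \<in> syzygies RR u v"
      "c \<in> C" "d \<in> C" by blast
    have R': "p \<in> R" "q \<in> R" using *(4) by (auto simp: syzygies_RR)
    note m' = m R_in_T[OF R'(1)] R_in_T[OF R'(2)] C.Icarr[OF *(5)] C.Icarr[OF *(6)]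
    have "c \<otimes> u \<oplus> d \<otimes> v = ((p \<oplus> c) \<otimes> u \<oplus> (q \<oplus> d) \<otimes> v) \<ominus> (p \<otimes> u \<oplus> q \<otimes> v)"
      using m' by algebra
    also have "\<dots> = \<zero>" using xy *(4) unfolding *(1,2) syzygies_RR by (simp add: minus_eq)
    finally have cd: "c \<otimes> u \<oplus> d \<otimes> v = \<zero>" .
    \<comment> \<open>The coefficients \<open>\<alpha>\<close> and \<open>\<beta>\<close> lie only
      in \<open>T\<close>, but \<open>c\<close> and \<open>d\<close> lie in \<open>C\<close>, so
      \<open>?l\<close> is in \<open>C\<close> and is an admissible scalar from
      \<open>R\<close>.\<close>
    let ?l = "\<beta> \<otimes> c \<ominus> \<alpha> \<otimes> d"
    have "?l \<in> C" using C.I_l_closed[OF *(5) uv(4)] C.I_l_closed[OF *(6) uv(3)] by (simp add: minus_eq)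
    then have "(?l \<otimes> v, ?l \<otimes> \<ominus> u) \<in> N" using N(2) Nc(4)[of ?l v "\<ominus> u"] by auto
    then have "(c, d) \<in> N"
      using unimodular_syzygy[OF m m'(7,8) uv(5) cd] by simp
    then show "(x, y) \<in> N" unfolding *(1,2) using Nc(3) *(3) by blast
  qed
  then show ?thesis
    unfolding syzygies_fg_def using S(1) f(1) vu
    by (intro exI[of _ "insert (v, \<ominus> u) (f ` S)"]) auto
qed

text \<open>As \<open>T\<close> is a domain, multiplying by \<open>r\<close> and cancelling
  \<open>s\<close> shows that \<open>x\<close>, \<open>y\<close> and the unimodular pair
  \<open>u\<close>, \<open>v\<close> have the same relations over \<open>R\<close>; those on
  \<open>u\<close>, \<open>v\<close> are controlled by \<open>A\<close>.\<close>

lemma finite_conductor_A_imp_R: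
  assumes "finite_conductor_ring A"
  shows "finite_conductor_ring RR"
  unfolding RR.finite_conductor_ring_iff
proof (intro ballI)
  fix x y assume "x \<in> carrier RR" "y \<in> carrier RR"
  then have xy: "x \<in> R" "y \<in> R" by simp_all
  show "syzygies_fg RR x y"
  proof (cases "x = \<zero> \<and> y = \<zero>")
    case True
    then show ?thesis using RR.syzygies_fg_zero by simp
  next
    case False
    then obtain r s u v r' \<alpha> \<beta> where e: "r \<in> R" "s \<in> R" "u \<in> R" "v \<in> R"
      "r' \<in> carrier T" "\<alpha> \<in> carrier T" "\<beta> \<in> carrier T" "r' \<otimes> r = \<one>" "s \<noteq> \<zero>"
      "r \<otimes> x = s \<otimes> u" "r \<otimes> y = s \<otimes> v" "\<alpha> \<otimes> u \<oplus> \<beta> \<otimes> v = \<one>"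
      using ex_unimodular[OF xy] by metis
    have "syzygies_fg A (h u) (h v)"
      using assms h_closed e(3,4) unfolding A.finite_conductor_ring_iff by blast
    then have "syzygies_fg RR u v" using syzygies_fg_RR_unimodular[OF e(3,4,6,7,12)] by blast
    moreover have "p \<otimes> x \<oplus> q \<otimes> y = \<zero> \<longleftrightarrow> p \<otimes> u \<oplus> q \<otimes> v = \<zero>" if pq: "p \<in> R" "q \<in> R" for p q
    proof -
      note m = R_in_T[OF e(1)] R_in_T[OF e(2)] R_in_T[OF e(3)] R_in_T[OF e(4)] e(5)
        R_in_T[OF xy(1)] R_in_T[OF xy(2)] R_in_T[OF pq(1)] R_in_T[OF pq(2)]
      have "r \<noteq> \<zero>" using e(8) m by auto
      then have "p \<otimes> x \<oplus> q \<otimes> y = \<zero> \<longleftrightarrow> r \<otimes> (p \<otimes> x \<oplus> q \<otimes> y) = \<zero>"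
        using m by (simp add: integral_iff)
      also have "r \<otimes> (p \<otimes> x \<oplus> q \<otimes> y) = p \<otimes> (r \<otimes> x) \<oplus> q \<otimes> (r \<otimes> y)" using m by algebra
      also have "\<dots> = s \<otimes> (p \<otimes> u \<oplus> q \<otimes> v)" unfolding e(10,11) using m by algebra
      also have "\<dots> = \<zero> \<longleftrightarrow> p \<otimes> u \<oplus> q \<otimes> v = \<zero>" using m e(9) by (simp add: integral_iff)
      finally show ?thesis .
    qed
    then have "syzygies RR x y = syzygies RR u v" unfolding syzygies_RR by blast
    ultimately show ?thesis unfolding syzygies_fg_def by simp
  qed
qed

section \<open>The conductor property passes from \<open>R\<close> to \<open>A\<close>\<close>

text \<open>Conversely, let \<open>r \<otimes> x = s \<otimes> u\<close> and \<open>r \<otimes> y = s \<otimes> v\<close> with \<open>u, v\<close> unimodular and let the idempotent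
  \<open>f\<close> generate the annihilator of \<open>s\<close> in \<open>A\<close>. Then \<open>(p, q)\<close> is a relation on \<open>x, y\<close> over \<open>A\<close>
  iff \<open>\<one> \<ominus> f\<close> times it is one on \<open>u, v\<close>.\<close>

lemma finite_conductor_R_imp_A:
  assumes ld: "locally_domain A" and R: "finite_conductor_ring RR"
  shows "finite_conductor_ring A"
  unfolding A.finite_conductor_ring_iff
proof (intro ballI)
  fix a b assume "a \<in> carrier A" "b \<in> carrier A"
  then obtain x y where xy: "x \<in> R" "y \<in> R" and ab: "a = h x" "b = h y" by (auto simp: carrier_A)
  show "syzygies_fg A a b"
  proof (cases "x = \<zero> \<and> y = \<zero>")
    case True
    then show ?thesis using A.syzygies_fg_zero by (simp add: ab h_zero)
  next
    case False
    then obtain r s u v r' \<alpha> \<beta> where e: "r \<in> R" "s \<in> R" "u \<in> R" "v \<in> R"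
      "r' \<in> carrier T" "\<alpha> \<in> carrier T" "\<beta> \<in> carrier T" "r' \<otimes> r = \<one>" "s \<noteq> \<zero>"
      "r \<otimes> x = s \<otimes> u" "r \<otimes> y = s \<otimes> v" "\<alpha> \<otimes> u \<oplus> \<beta> \<otimes> v = \<one>"
      using ex_unimodular[OF xy] by metis
    obtain f where f: "f \<in> R" "f \<otimes> s \<in> C" "\<And>z. z \<in> R \<Longrightarrow> z \<otimes> s \<in> C \<Longrightarrow> (\<one> \<ominus> f) \<otimes> z \<in> C"
      using annihilator_idempotent[OF ld e(2)] by blast
    have "syzygies_fg RR u v" using R e(3,4) by (simp add: RR.finite_conductor_ring_iff)
    then obtain S where S: "finite S" "S \<subseteq> syzygies RR u v"
      "\<And>N. pair_submodule RR N \<Longrightarrow> S \<subseteq> N \<Longrightarrow> syzygies RR u v \<subseteq> N"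
      unfolding syzygies_fg_def by blast
    note m = R_in_T[OF e(1)] R_in_T[OF e(2)] R_in_T[OF e(3)] R_in_T[OF e(4)] e(5-7)
      R_in_T[OF xy(1)] R_in_T[OF xy(2)] R_in_T[OF f(1)]
    \<comment> \<open>The inverse of \<open>r\<close> lies in \<open>T\<close>; as \<open>C\<close>
      is an ideal of \<open>T\<close>, it still allows \<open>r\<close> to be cancelled modulo
      \<open>C\<close>.\<close>
    have r': "z \<in> C" if "z \<in> carrier T" "r \<otimes> z \<in> C" for z
    proof -
      have "z = r' \<otimes> (r \<otimes> z)" using m that(1) e(8) by (simp add: m_assoc[symmetric])
      then show ?thesis using C.I_l_closed[OF that(2) e(5)] by simp
    qed
    have key: "r \<otimes> (p \<otimes> x \<oplus> q \<otimes> y) = s \<otimes> (p \<otimes> u \<oplus> q \<otimes> v)"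
      if "p \<in> carrier T" "q \<in> carrier T" for p q
    proof -
      have "r \<otimes> (p \<otimes> x \<oplus> q \<otimes> y) = p \<otimes> (r \<otimes> x) \<oplus> q \<otimes> (r \<otimes> y)" using m that by algebra
      also have "\<dots> = s \<otimes> (p \<otimes> u \<oplus> q \<otimes> v)" unfolding e(10,11) using m that by algebra
      finally show ?thesis .
    qed
    \<comment> \<open>Modulo \<open>C\<close> the element \<open>f\<close> kills \<open>s\<close>,
      hence also \<open>x\<close> and \<open>y\<close>, so \<open>(f, \<zero>)\<close> and
      \<open>(\<zero>, f)\<close> are relations over \<open>A\<close>; they account for what the
      relations on \<open>u\<close>, \<open>v\<close> miss.\<close>
    let ?S = "insert (f, \<zero>) (insert (\<zero>, f) S)"
    have "S \<subseteq> syzygies_mod x y"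
    proof (clarify)
      fix p q assume "(p, q) \<in> S"
      then have pq: "p \<in> R" "q \<in> R" "p \<otimes> u \<oplus> q \<otimes> v = \<zero>" using S(2) by (auto simp: syzygies_RR)
      then have "r \<otimes> (p \<otimes> x \<oplus> q \<otimes> y) = \<zero>" using key m by simp
      then show "(p, q) \<in> syzygies_mod x y"
        using pq(1,2) r'[of "p \<otimes> x \<oplus> q \<otimes> y"] m C.zero_closed by (simp add: syzygies_mod_def)
    qed
    moreover have "f \<otimes> x \<in> C" "f \<otimes> y \<in> C"
    proof -
      have "r \<otimes> (f \<otimes> x) = f \<otimes> (r \<otimes> x)" using m by algebra
      also have "\<dots> = f \<otimes> s \<otimes> u" unfolding e(10) using m by algebra
      finally show "f \<otimes> x \<in> C" using r'[of "f \<otimes> x"] C.I_r_closed[OF f(2)] m by simp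
      have "r \<otimes> (f \<otimes> y) = f \<otimes> (r \<otimes> y)" using m by algebra
      also have "\<dots> = f \<otimes> s \<otimes> v" unfolding e(11) using m by algebra
      finally show "f \<otimes> y \<in> C" using r'[of "f \<otimes> y"] C.I_r_closed[OF f(2)] m by simp
    qed
    ultimately have sub: "?S \<subseteq> syzygies_mod x y"
      using f(1) xy m by (auto simp: syzygies_mod_def)
    have "syzygies_mod x y \<subseteq> N" if N: "pair_submodule RR N" "C \<times> C \<subseteq> N" "?S \<subseteq> N" for N
    proof (clarify)
      note Nc = pair_submoduleD[OF N(1), simplified]
      fix p q assume "(p, q) \<in> syzygies_mod x y"
      then have pq: "p \<in> R" "q \<in> R" "p \<otimes> x \<oplus> q \<otimes> y \<in> C" by (auto simp: syzygies_mod_def)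
      note m' = m R_in_T[OF pq(1)] R_in_T[OF pq(2)]
      have "s \<otimes> (p \<otimes> u \<oplus> q \<otimes> v) \<in> C"
        using key[of p q] C.I_l_closed[OF pq(3) m(1)] m' by simp
      then have "(p \<otimes> u \<oplus> q \<otimes> v) \<otimes> s \<in> C" using m' by (simp add: m_comm)
      then have "(\<one> \<ominus> f) \<otimes> (p \<otimes> u \<oplus> q \<otimes> v) \<in> C" using f(3) pq e(3,4) by simp
      moreover have "(\<one> \<ominus> f) \<otimes> (p \<otimes> u \<oplus> q \<otimes> v) = (\<one> \<ominus> f) \<otimes> p \<otimes> u \<oplus> (\<one> \<ominus> f) \<otimes> q \<otimes> v"
        using m' by algebra
      ultimately obtain c d where cd: "c \<in> C" "d \<in> C"
        "((\<one> \<ominus> f) \<otimes> p \<ominus> c, (\<one> \<ominus> f) \<otimes> q \<ominus> d) \<in> syzygies RR u v"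
        using lift_syzygy[OF e(3,4,6,7,12), of "(\<one> \<ominus> f) \<otimes> p" "(\<one> \<ominus> f) \<otimes> q"] f(1) pq by auto
      then have 1: "((\<one> \<ominus> f) \<otimes> p \<ominus> c, (\<one> \<ominus> f) \<otimes> q \<ominus> d) \<in> N" using S(3) N by blast
      have 2: "(c, d) \<in> N" using N(2) cd by blast
      have 3: "(p \<otimes> f, p \<otimes> \<zero>) \<in> N" "(q \<otimes> \<zero>, q \<otimes> f) \<in> N" using N(3) pq by (auto intro!: Nc(4) simp del: r_null)
      \<comment> \<open>The pair \<open>(p, q)\<close> splits into its multiples by
        \<open>\<one> \<ominus> f\<close> and by \<open>f\<close>: the first is a relation on
        \<open>u\<close>, \<open>v\<close> plus \<open>(c, d)\<close>, the second a combination of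
        \<open>(f, \<zero>)\<close> and \<open>(\<zero>, f)\<close>.\<close>
      have "((((\<one> \<ominus> f) \<otimes> p \<ominus> c) \<oplus> c) \<oplus> (p \<otimes> f \<oplus> q \<otimes> \<zero>),
          (((\<one> \<ominus> f) \<otimes> q \<ominus> d) \<oplus> d) \<oplus> (p \<otimes> \<zero> \<oplus> q \<otimes> f)) \<in> N"
        by (intro Nc(3) 1 2 3)
      moreover have "(((\<one> \<ominus> f) \<otimes> p \<ominus> c) \<oplus> c) \<oplus> (p \<otimes> f \<oplus> q \<otimes> \<zero>) = p"
        "(((\<one> \<ominus> f) \<otimes> q \<ominus> d) \<oplus> d) \<oplus> (p \<otimes> \<zero> \<oplus> q \<otimes> f) = q"
        using m' C.Icarr[OF cd(1)] C.Icarr[OF cd(2)] by algebra+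
      ultimately show "(p, q) \<in> N" by simp
    qed
    then show ?thesis
      unfolding ab syzygies_fg_A_iff[OF xy] using S(1) sub by (intro exI[of _ ?S]) simp
  qed
qed

end

theorem theorem4p7:
  fixes T :: "('a, 'm) ring_scheme" and R C :: "'a set"
  assumes square: "regular_conductor_square T R C"
    and flat: "flat_module (T\<lparr>carrier := R\<rparr>) (mult_module T (carrier T))"
    and principal: "principalideal C T"
    and two_gen: "\<And>I. two_generated (T\<lparr>carrier := R\<rparr>) I \<Longrightarrow> I \<noteq> {\<zero>\<^bsub>T\<^esub>} \<Longrightarrow>
      \<exists>r\<in>R. \<exists>s\<in>R. \<exists>U. ideal U (T\<lparr>carrier := R\<rparr>) \<and>
        Idl\<^bsub>T\<^esub> U = carrier T \<and> PIdl\<^bsub>T\<^esub> r = carrier T \<and> r <#\<^bsub>T\<^esub> I = s <#\<^bsub>T\<^esub> U \<and>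
        (\<lambda>x. r \<otimes>\<^bsub>T\<^esub> x) \<in> module_iso (T\<lparr>carrier := R\<rparr>) (mult_module T I) (mult_module T (r <#\<^bsub>T\<^esub> I)) \<and>
        (\<lambda>x. s \<otimes>\<^bsub>T\<^esub> x) \<in> module_iso (T\<lparr>carrier := R\<rparr>) (mult_module T U) (mult_module T (s <#\<^bsub>T\<^esub> U))"
    and locally_domain: "locally_domain (T\<lparr>carrier := R\<rparr> Quot C)"
    and finite_dim: "krull_dim (T\<lparr>carrier := R\<rparr> Quot C) < \<infinity>"
  shows "(finite_conductor_ring (T\<lparr>carrier := R\<rparr>) \<longleftrightarrow>
          finite_conductor_ring (T\<lparr>carrier := R\<rparr> Quot C)) \<and>
         (finite_conductor_ring (T\<lparr>carrier := R\<rparr>) \<longrightarrow> finite_conductor_ring T) \<and>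
         (finite_conductor_ring (T\<lparr>carrier := R\<rparr> Quot C) \<longrightarrow> finite_conductor_ring T)"
proof -
  interpret unimodular_square T R C
    by (rule unimodular_square.intro[OF square unimodular_square_axioms.intro[OF principal two_gen]])
  show ?thesis
    using finite_conductor_T finite_conductor_A_imp_R finite_conductor_R_imp_A[OF locally_domain]
    by blast
qed

end
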